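(* Let $N\in\mathbb{N}$ and let $w\in\mathcal{A}_N^{\mathbb{N}}$ be a non-periodic uniformly recurrent infinite word. If there is a constant $C$, independent of $n$, such that the number of connected components of $G_n$ is at most $C$ for every $n\in\mathbb{N}$, then $(w,\mathbf{x}_p)\notin\mathbf{LMad}$ for every $\mathbf{x}_p\in\mathbf{P}^1(\mathbb{Q}_p)$.
   Context: A word is uniformly recurrent if every finite factor occurs infinitely often and the gaps between consecutive occurrences of each factor are bounded. For $n\in\mathbb{N}$, $G_n=(S_n,T_n,E_n)$ is the bipartite graph where $S_n$ and $T_n$ are two (disjoint) copies of the set of distinct factors of $w$ of length $n$, and $s\in S_n$, $t\in T_n$ are joined by an edge iff the concatenation $st$ is a factor of $w$. Fix a prime $p$; $|\cdot|_p$ is the $p$-adic absolute value. $\mathcal{A}_N=\{1,\ldots,N\}$. For $a\in\mathbb{N}$, $A_a=\begin{pmatrix}0&1\\1&a\end{pmatrix}$. For an infinite word $w=a_1a_2\ldots$, $\mathrm{T}w=a_2a_3\ldots$; points of $\mathbf{P}^1(\mathbb{Q}_p)$ are column vectors $(q_1,q_2)^T$ in homogeneous coordinates and $\mathrm{T}(w,\mathbf{q})=(\mathrm{T}w,A_{a_1}\mathbf{q})$. For $\epsilon>0$, $(q_1,q_2)\in\mathbf{PBad}_\epsilon$ if for all $(a,b)\in\mathbb{Z}^2\setminus\{(0,0)\}$, $\frac{|aq_1+bq_2|_p}{\max\{|q_1|_p,|q_2|_p\}}\ge\frac{\epsilon}{\max\{a^2,b^2\}}$. $\mathbf{LMad}_\epsilon$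 is the set of pairs $(w,\mathbf{x}_p)$ with $\mathrm{T}^n(w,\mathbf{x}_p)\in\mathcal{A}_{N'}^{\mathbb{N}}\times\mathbf{PBad}_\epsilon$ for all integers $n\ge0$, where $N'=\lfloor\epsilon^{-1}\rfloor+1$; $\mathbf{LMad}=\bigcup_{\epsilon>0}\mathbf{LMad}_\epsilon$. *)

theory Defs
  imports
    "HOL-Analysis.Analysis"
    "HOL-Library.Omega_Words_Fun"
    "Berlekamp_Zassenhaus.Finite_Field"
begin

section \<open>The p-adic absolute value on the rationals\<close>

definition rat_padic_abs :: "nat \<Rightarrow> rat \<Rightarrow> real" where
  "rat_padic_abs p q = (if q = 0 then 0 else
     (case quotient_of q of (a, b) \<Rightarrow>
        real p powi (int (multiplicity (int p) b) - int (multiplicity (int p) a))))"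

lemma rat_padic_abs_0 [simp]: "rat_padic_abs p 0 = 0"
  by (simp add: rat_padic_abs_def)

lemma rat_padic_abs_frac:
  assumes p: "prime p" and "a \<noteq> 0" "b \<noteq> 0"
  shows "rat_padic_abs p (of_int a / of_int b) =
    real p powi (int (multiplicity (int p) b) - int (multiplicity (int p) a))"
proof -
  define q :: rat where "q = of_int a / of_int b"
  obtain c d where cd: "quotient_of q = (c, d)" by fastforce
  have q: "q = of_int c / of_int d" by (rule quotient_of_div[OF cd])
  have d: "d > 0" by (rule quotient_of_denom_pos[OF cd])
  have q0: "q \<noteq> 0" using assms by (simp add: q_def)
  hence c: "c \<noteq> 0" using q by auto
  have "(of_int (a * d) :: rat) = of_int (c * b)"
    using q d assms unfolding q_def by (simp add: field_simps)
  hence eq: "a * d = c * b" by (simp only: of_int_eq_iff)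
  have pe: "prime_elem (int p)" using p by simp
  have "multiplicity (int p) a + multiplicity (int p) d = multiplicity (int p) c + multiplicity (int p) b"
    using eq prime_elem_multiplicity_mult_distrib[OF pe, of a d]
      prime_elem_multiplicity_mult_distrib[OF pe, of c b] assms c d by simp
  hence "int (multiplicity (int p) d) - int (multiplicity (int p) c) =
    int (multiplicity (int p) b) - int (multiplicity (int p) a)" by linarith
  thus ?thesis using q0 cd unfolding q_def[symmetric] by (simp add: rat_padic_abs_def)
qed

lemma rat_padic_abs_of_int:
  assumes "prime p" "a \<noteq> 0"
  shows "rat_padic_abs p (of_int a) = 1 / real p ^ multiplicity (int p) a"
  using rat_padic_abs_frac[OF assms(1,2), of 1]
  by (simp add: power_int_minus divide_inverse)

lemma rat_padic_abs_1 [simp]: "prime p \<Longrightarrow> rat_padic_abs p 1 = 1"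
  using rat_padic_abs_of_int[of p 1] by simp

lemma rat_padic_abs_nonneg [simp]: "rat_padic_abs p q \<ge> 0"
  by (auto simp: rat_padic_abs_def split: prod.split)

lemma rat_padic_abs_eq_0_iff [simp]: "prime p \<Longrightarrow> rat_padic_abs p q = 0 \<longleftrightarrow> q = 0"
  by (auto simp: rat_padic_abs_def prime_gt_0_nat split: prod.split)

lemma rat_as_frac:
  fixes q :: rat
  obtains a b where "b \<noteq> 0" "q = of_int a / of_int b"
  by (metis quotient_of_div quotient_of_denom_pos surj_pair less_irrefl)

lemma rat_padic_abs_mult:
  assumes p: "prime p"
  shows "rat_padic_abs p (x * y) = rat_padic_abs p x * rat_padic_abs p y"
proof (cases "x = 0 \<or> y = 0")
  case False
  obtain a b where ab: "b \<noteq> 0" "x = of_int a / of_int b" by (rule rat_as_frac)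
  obtain c d where cd: "d \<noteq> 0" "y = of_int c / of_int d" by (rule rat_as_frac)
  have nz: "a \<noteq> 0" "c \<noteq> 0" using False ab cd by auto
  have pe: "prime_elem (int p)" using p by simp
  have p0: "real p \<noteq> 0" using p by (simp add: prime_gt_0_nat)
  have xy: "x * y = of_int (a * c) / of_int (b * d)" using ab cd by simp
  show ?thesis
    unfolding xy unfolding ab(2) cd(2) using ab(1) cd(1) nz p0
    by (simp only: rat_padic_abs_frac[OF p] mult_eq_0_iff simp_thms
        prime_elem_multiplicity_mult_distrib[OF pe] of_nat_add flip: power_int_add)
       (simp add: power_int_add[symmetric] algebra_simps)
qed auto

lemma rat_padic_abs_inverse:
  assumes p: "prime p"
  shows "rat_padic_abs p (inverse x) = inverse (rat_padic_abs p x)"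
proof (cases "x = 0")
  case False
  have "rat_padic_abs p (inverse x) * rat_padic_abs p x = 1"
    using False p by (simp flip: rat_padic_abs_mult)
  thus ?thesis by (metis inverse_unique mult.commute)
qed auto

lemma rat_padic_abs_minus [simp]:
  assumes p: "prime p"
  shows "rat_padic_abs p (- x) = rat_padic_abs p x"
proof -
  have "rat_padic_abs p (-1) = 1"
    using rat_padic_abs_of_int[OF p, of "-1"] p by (simp add: multiplicity_unit_right)
  thus ?thesis using rat_padic_abs_mult[OF p, of "-1" x] by simp
qed

lemma rat_padic_abs_minus_commute:
  "prime p \<Longrightarrow> rat_padic_abs p (x - y) = rat_padic_abs p (y - x)"
  using rat_padic_abs_minus[of p "x - y"] by simp

lemma rat_padic_abs_ultra_int:
  assumes p: "prime p"
  shows "rat_padic_abs p (of_int (a + b)) \<le> max (rat_padic_abs p (of_int a)) (rat_padic_abs p (of_int b))"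
proof (cases "a = 0 \<or> b = 0 \<or> a + b = 0")
  case False
  define m where "m = min (multiplicity (int p) a) (multiplicity (int p) b)"
  have "int p ^ m dvd a" "int p ^ m dvd b"
    unfolding m_def by (auto intro: multiplicity_dvd')
  hence "int p ^ m dvd a + b" by simp
  hence "m \<le> multiplicity (int p) (a + b)"
    using False p by (intro multiplicity_geI) (auto simp: prime_int_nat_transfer)
  hence "1 / real p ^ multiplicity (int p) (a + b) \<le> 1 / real p ^ m"
    using p by (intro divide_left_mono power_increasing)
      (auto simp: prime_gt_0_nat prime_ge_1_nat Suc_leI)
  also have "\<dots> \<le> max (1 / real p ^ multiplicity (int p) a) (1 / real p ^ multiplicity (int p) b)"
    unfolding m_def by (auto simp: min_def)
  finally show ?thesis using False rat_padic_abs_of_int[OF p] by metis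
qed (auto simp: le_max_iff_disj simp flip: of_int_add)

lemma rat_padic_abs_ultra:
  assumes p: "prime p"
  shows "rat_padic_abs p (x + y) \<le> max (rat_padic_abs p x) (rat_padic_abs p y)"
proof -
  obtain a b where ab: "b \<noteq> 0" "x = of_int a / of_int b" by (rule rat_as_frac)
  obtain c d where cd: "d \<noteq> 0" "y = of_int c / of_int d" by (rule rat_as_frac)
  define z :: rat where "z = inverse (of_int (b * d))"
  have e: "x = of_int (a * d) * z" "y = of_int (c * b) * z" "x + y = of_int (a * d + c * b) * z"
    using ab cd by (auto simp: z_def field_simps)
  show ?thesis
    unfolding e(3) unfolding e(1,2) rat_padic_abs_mult[OF p]
    using mult_right_mono[OF rat_padic_abs_ultra_int[OF p, of "a * d" "c * b"], of "rat_padic_abs p z"]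
    by (simp add: max_mult_distrib_right)
qed

lemma rat_padic_abs_triangle:
  assumes p: "prime p"
  shows "rat_padic_abs p (x + y) \<le> rat_padic_abs p x + rat_padic_abs p y"
  using rat_padic_abs_ultra[OF p, of x y] rat_padic_abs_nonneg[of p x] rat_padic_abs_nonneg[of p y]
  by linarith

lemma rat_padic_abs_eqI:
  assumes p: "prime p" and "rat_padic_abs p (x - y) < rat_padic_abs p y"
  shows "rat_padic_abs p x = rat_padic_abs p y"
  using rat_padic_abs_ultra[OF p, of "x - y" y] rat_padic_abs_ultra[OF p, of x "y - x"] assms
    rat_padic_abs_minus_commute[OF p, of x y]
  by (simp add: max_def split: if_splits)


section \<open>The field of p-adic numbers\<close>

definition padic_Cauchy :: "nat \<Rightarrow> (nat \<Rightarrow> rat) \<Rightarrow> bool" where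
  "padic_Cauchy p X \<longleftrightarrow>
     (\<forall>e>0. \<exists>M. \<forall>m\<ge>M. \<forall>n\<ge>M. rat_padic_abs p (X m - X n) < e)"

definition padic_null :: "nat \<Rightarrow> (nat \<Rightarrow> rat) \<Rightarrow> bool" where
  "padic_null p X \<longleftrightarrow> (\<lambda>n. rat_padic_abs p (X n)) \<longlonglongrightarrow> 0"

lemma padic_nullD: "padic_null p X \<Longrightarrow> e > 0 \<Longrightarrow> \<exists>M. \<forall>n\<ge>M. rat_padic_abs p (X n) < e"
  unfolding padic_null_def LIMSEQ_iff by auto

lemma padic_nullI: "(\<And>e. e > 0 \<Longrightarrow> \<exists>M. \<forall>n\<ge>M. rat_padic_abs p (X n) < e) \<Longrightarrow> padic_null p X"
  unfolding padic_null_def LIMSEQ_iff by auto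

lemma padic_CauchyD:
  "padic_Cauchy p X \<Longrightarrow> e > 0 \<Longrightarrow> \<exists>M. \<forall>m\<ge>M. \<forall>n\<ge>M. rat_padic_abs p (X m - X n) < e"
  by (simp add: padic_Cauchy_def)

lemma padic_Cauchy_const [simp]: "padic_Cauchy p (\<lambda>_. c)"
  by (simp add: padic_Cauchy_def)

lemma padic_null_0 [simp]: "padic_null p (\<lambda>_. 0)"
  by (simp add: padic_null_def)

lemma padic_null_add:
  assumes p: "prime p" and "padic_null p X" "padic_null p Y"
  shows "padic_null p (\<lambda>n. X n + Y n)"
proof (rule padic_nullI)
  fix e :: real assume "e > 0"
  then obtain M1 M2 where "\<forall>n\<ge>M1. rat_padic_abs p (X n) < e" "\<forall>n\<ge>M2. rat_padic_abs p (Y n) < e"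
    using assms padic_nullD by blast
  thus "\<exists>M. \<forall>n\<ge>M. rat_padic_abs p (X n + Y n) < e"
    by (intro exI[of _ "max M1 M2"]) (auto intro: le_less_trans[OF rat_padic_abs_ultra[OF p]])
qed

lemma padic_null_minus: "prime p \<Longrightarrow> padic_null p (\<lambda>n. - X n) \<longleftrightarrow> padic_null p X"
  by (simp add: padic_null_def)

lemma padic_Cauchy_add:
  assumes p: "prime p" and "padic_Cauchy p X" "padic_Cauchy p Y"
  shows "padic_Cauchy p (\<lambda>n. X n + Y n)"
  unfolding padic_Cauchy_def
proof (intro allI impI)
  fix e :: real assume "e > 0"
  then obtain M1 M2 where M: "\<forall>m\<ge>M1. \<forall>n\<ge>M1. rat_padic_abs p (X m - X n) < e"
    "\<forall>m\<ge>M2. \<forall>n\<ge>M2. rat_padic_abs p (Y m - Y n) < e"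
    using assms padic_CauchyD by meson
  have "rat_padic_abs p (X m + Y m - (X n + Y n)) < e" if "m \<ge> max M1 M2" "n \<ge> max M1 M2" for m n
    using M that rat_padic_abs_ultra[OF p, of "X m - X n" "Y m - Y n"]
    by (simp add: algebra_simps) (smt (verit))
  thus "\<exists>M. \<forall>m\<ge>M. \<forall>n\<ge>M. rat_padic_abs p (X m + Y m - (X n + Y n)) < e" by blast
qed

lemma padic_Cauchy_minus:
  "prime p \<Longrightarrow> padic_Cauchy p X \<Longrightarrow> padic_Cauchy p (\<lambda>n. - X n)"
  by (simp add: padic_Cauchy_def rat_padic_abs_minus_commute)

lemma padic_Cauchy_nonnull:
  assumes p: "prime p" and X: "padic_Cauchy p X" and nn: "\<not> padic_null p X"
  obtains r M where "r > 0" "\<And>n. n \<ge> M \<Longrightarrow> rat_padic_abs p (X n) = r"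
proof -
  obtain e where e: "e > 0" "\<And>M. \<exists>n\<ge>M. rat_padic_abs p (X n) \<ge> e"
    using nn padic_nullI[of p X] by (meson not_le)
  obtain M where M: "\<And>m n. m \<ge> M \<Longrightarrow> n \<ge> M \<Longrightarrow> rat_padic_abs p (X m - X n) < e"
    using padic_CauchyD[OF X e(1)] by blast
  obtain m where m: "m \<ge> M" "rat_padic_abs p (X m) \<ge> e" using e(2) by blast
  have "rat_padic_abs p (X n) = rat_padic_abs p (X m)" if "n \<ge> M" for n
    using M[OF that m(1)] m(2) by (intro rat_padic_abs_eqI[OF p]) auto
  thus ?thesis using that[of "rat_padic_abs p (X m)" M] e(1) m(2) by auto
qed

lemma padic_Cauchy_convergent_abs:
  assumes p: "prime p" and X: "padic_Cauchy p X"
  shows "convergent (\<lambda>n. rat_padic_abs p (X n))"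
proof (cases "padic_null p X")
  case True
  thus ?thesis by (auto simp: padic_null_def convergent_def)
next
  case False
  then obtain r M where "\<And>n. n \<ge> M \<Longrightarrow> rat_padic_abs p (X n) = r"
    using padic_Cauchy_nonnull[OF p X] by metis
  hence "(\<lambda>n. rat_padic_abs p (X n)) \<longlonglongrightarrow> r"
    by (intro tendsto_eventually) (auto simp: eventually_sequentially)
  thus ?thesis by (auto simp: convergent_def)
qed

lemma padic_Cauchy_bounded:
  assumes p: "prime p" and X: "padic_Cauchy p X"
  obtains B where "B > 0" "\<And>n. rat_padic_abs p (X n) \<le> B"
proof -
  have "Bseq (\<lambda>n. rat_padic_abs p (X n))"
    using padic_Cauchy_convergent_abs[OF p X] by (rule convergent_imp_Bseq)
  thus ?thesis using that by (auto elim!: BseqE)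
qed

lemma padic_null_mult_Cauchy:
  assumes p: "prime p" and X: "padic_Cauchy p X" and Y: "padic_null p Y"
  shows "padic_null p (\<lambda>n. X n * Y n)"
proof -
  obtain B where B: "B > 0" "\<And>n. rat_padic_abs p (X n) \<le> B"
    using padic_Cauchy_bounded[OF p X] by metis
  have "(\<lambda>n. B * rat_padic_abs p (Y n)) \<longlonglongrightarrow> 0"
    using Y unfolding padic_null_def by (rule tendsto_mult_right_zero)
  thus ?thesis unfolding padic_null_def
    by (rule Lim_null_comparison[rotated])
       (auto simp: rat_padic_abs_mult[OF p] B intro!: mult_right_mono always_eventually)
qed

lemma padic_Cauchy_mult:
  assumes p: "prime p" and X: "padic_Cauchy p X" and Y: "padic_Cauchy p Y"
  shows "padic_Cauchy p (\<lambda>n. X n * Y n)"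
  unfolding padic_Cauchy_def
proof (intro allI impI)
  fix e :: real assume e: "e > 0"
  obtain B where B: "B > 0" "\<And>n. rat_padic_abs p (X n) \<le> B"
    using padic_Cauchy_bounded[OF p X] by metis
  obtain C where C: "C > 0" "\<And>n. rat_padic_abs p (Y n) \<le> C"
    using padic_Cauchy_bounded[OF p Y] by metis
  obtain M1 where M1: "\<forall>m\<ge>M1. \<forall>n\<ge>M1. rat_padic_abs p (X m - X n) < e / C"
    using padic_CauchyD[OF X] e C by (meson divide_pos_pos)
  obtain M2 where M2: "\<forall>m\<ge>M2. \<forall>n\<ge>M2. rat_padic_abs p (Y m - Y n) < e / B"
    using padic_CauchyD[OF Y] e B by (meson divide_pos_pos)
  have "rat_padic_abs p (X m * Y m - X n * Y n) < e" if "m \<ge> max M1 M2" "n \<ge> max M1 M2" for m n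
  proof -
    have "rat_padic_abs p (X m * (Y m - Y n)) \<le> B * rat_padic_abs p (Y m - Y n)"
      by (simp add: rat_padic_abs_mult[OF p] B mult_right_mono)
    also have "\<dots> < B * (e / B)" using M2 that B by (intro mult_strict_left_mono) auto
    finally have 1: "rat_padic_abs p (X m * (Y m - Y n)) < e" using B by simp
    have "rat_padic_abs p ((X m - X n) * Y n) \<le> rat_padic_abs p (X m - X n) * C"
      by (simp add: rat_padic_abs_mult[OF p] C mult_left_mono)
    also have "\<dots> < (e / C) * C" using M1 that C by (intro mult_strict_right_mono) auto
    finally have 2: "rat_padic_abs p ((X m - X n) * Y n) < e" using C by simp
    have "X m * Y m - X n * Y n = X m * (Y m - Y n) + (X m - X n) * Y n"
      by (simp add: algebra_simps)
    thus ?thesis using 1 2 rat_padic_abs_ultra[OF p, of "X m * (Y m - Y n)" "(X m - X n) * Y n"]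
      by simp
  qed
  thus "\<exists>M. \<forall>m\<ge>M. \<forall>n\<ge>M. rat_padic_abs p (X m * Y m - X n * Y n) < e" by blast
qed

lemma padic_Cauchy_inverse:
  assumes p: "prime p" and X: "padic_Cauchy p X" and nn: "\<not> padic_null p X"
  shows "padic_Cauchy p (\<lambda>n. inverse (X n))"
  unfolding padic_Cauchy_def
proof (intro allI impI)
  fix e :: real assume e: "e > 0"
  obtain r M where r: "r > 0" "\<And>n. n \<ge> M \<Longrightarrow> rat_padic_abs p (X n) = r"
    using padic_Cauchy_nonnull[OF p X nn] by metis
  obtain M' where M': "\<forall>m\<ge>M'. \<forall>n\<ge>M'. rat_padic_abs p (X m - X n) < e * r\<^sup>2"
    using padic_CauchyD[OF X, of "e * r\<^sup>2"] e r by auto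
  have "rat_padic_abs p (inverse (X m) - inverse (X n)) < e" if mn: "m \<ge> max M M'" "n \<ge> max M M'" for m n
  proof -
    have nz: "X m \<noteq> 0" "X n \<noteq> 0" using r(1) r(2)[of m] r(2)[of n] mn by auto
    have eq: "inverse (X m) - inverse (X n) = (X n - X m) * inverse (X m) * inverse (X n)"
      using nz by (simp add: field_simps)
    have "rat_padic_abs p (inverse (X m) - inverse (X n)) = rat_padic_abs p (X n - X m) / r\<^sup>2"
      unfolding eq rat_padic_abs_mult[OF p] rat_padic_abs_inverse[OF p]
      using mn r by (simp add: divide_inverse power2_eq_square)
    also have "\<dots> < e" using M' mn r by (simp add: field_simps)
    finally show ?thesis .
  qed
  thus "\<exists>M. \<forall>m\<ge>M. \<forall>n\<ge>M. rat_padic_abs p (inverse (X m) - inverse (X n)) < e" by blast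
qed

text \<open>The prime is the cardinality of the type argument.\<close>

typedef ('p :: prime_card) padic_Cauchy_seq = "{X. padic_Cauchy CARD('p) X}"
  by (rule exI[of _ "\<lambda>_. 0"]) simp

setup_lifting type_definition_padic_Cauchy_seq

instantiation padic_Cauchy_seq :: (prime_card) comm_ring_1
begin

lift_definition zero_padic_Cauchy_seq :: "'a padic_Cauchy_seq" is "\<lambda>_. 0" by simp

lift_definition one_padic_Cauchy_seq :: "'a padic_Cauchy_seq" is "\<lambda>_. 1" by simp

lift_definition plus_padic_Cauchy_seq ::
  "'a padic_Cauchy_seq \<Rightarrow> 'a padic_Cauchy_seq \<Rightarrow> 'a padic_Cauchy_seq" is "\<lambda>X Y n. X n + Y n"
  by (rule padic_Cauchy_add[OF prime_card])

lift_definition uminus_padic_Cauchy_seq ::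
  "'a padic_Cauchy_seq \<Rightarrow> 'a padic_Cauchy_seq" is "\<lambda>X n. - X n"
  by (rule padic_Cauchy_minus[OF prime_card])

lift_definition minus_padic_Cauchy_seq ::
  "'a padic_Cauchy_seq \<Rightarrow> 'a padic_Cauchy_seq \<Rightarrow> 'a padic_Cauchy_seq" is "\<lambda>X Y n. X n - Y n"
  using padic_Cauchy_add[OF prime_card _ padic_Cauchy_minus[OF prime_card]] by fastforce

lift_definition times_padic_Cauchy_seq ::
  "'a padic_Cauchy_seq \<Rightarrow> 'a padic_Cauchy_seq \<Rightarrow> 'a padic_Cauchy_seq" is "\<lambda>X Y n. X n * Y n"
  by (rule padic_Cauchy_mult[OF prime_card])

instance
  by standard (transfer; force simp: algebra_simps fun_eq_iff)+

end

lift_definition padic_null_seq :: "'p::prime_card padic_Cauchy_seq \<Rightarrow> bool" is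
  "padic_null CARD('p)" .

lemma padic_null_seq_0 [simp]: "padic_null_seq 0"
  by transfer simp

lemma padic_null_seq_minus: "padic_null_seq X \<Longrightarrow> padic_null_seq (- X)"
  by transfer (simp add: padic_null_minus[OF prime_card])

lemma padic_null_seq_add: "padic_null_seq X \<Longrightarrow> padic_null_seq Y \<Longrightarrow> padic_null_seq (X + Y)"
  by transfer (simp add: padic_null_add[OF prime_card])

lemma padic_null_seq_mult: "padic_null_seq Y \<Longrightarrow> padic_null_seq (X * Y)"
  by transfer (simp add: padic_null_mult_Cauchy[OF prime_card])

definition padic_rel :: "'p::prime_card padic_Cauchy_seq \<Rightarrow> 'p padic_Cauchy_seq \<Rightarrow> bool" where
  "padic_rel X Y \<longleftrightarrow> padic_null_seq (X - Y)"

lemma equivp_padic_rel: "equivp (padic_rel :: 'p::prime_card padic_Cauchy_seq \<Rightarrow> _)"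
proof (rule equivpI)
  show "reflp (padic_rel :: 'p padic_Cauchy_seq \<Rightarrow> _)"
    by (simp add: reflp_def padic_rel_def)
  show "symp (padic_rel :: 'p padic_Cauchy_seq \<Rightarrow> _)"
    using padic_null_seq_minus by (fastforce simp: symp_def padic_rel_def)
  show "transp (padic_rel :: 'p padic_Cauchy_seq \<Rightarrow> _)"
    using padic_null_seq_add by (fastforce simp: transp_def padic_rel_def)
qed

lemma padic_rel_null: "padic_rel X Y \<Longrightarrow> padic_null_seq X \<longleftrightarrow> padic_null_seq Y"
  using padic_null_seq_add[of "X - Y" Y] padic_null_seq_add[of "- (X - Y)" X]
    padic_null_seq_minus[of "X - Y"]
  by (auto simp: padic_rel_def)

lift_definition padic_seq_inverse :: "'p::prime_card padic_Cauchy_seq \<Rightarrow> 'p padic_Cauchy_seq" is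
  "\<lambda>X. if padic_null CARD('p) X then (\<lambda>_. 0) else (\<lambda>n. inverse (X n))"
  by (auto intro: padic_Cauchy_inverse[OF prime_card])

lemma padic_seq_inverse_null: "padic_null_seq X \<Longrightarrow> padic_seq_inverse X = 0"
  by transfer simp

lemma padic_seq_inverse_mult:
  assumes "\<not> padic_null_seq (X :: 'p::prime_card padic_Cauchy_seq)"
  shows "padic_rel (padic_seq_inverse X * X) 1"
  unfolding padic_rel_def using assms
proof transfer
  fix X :: "nat \<Rightarrow> rat"
  assume C: "padic_Cauchy CARD('p) X" and nn: "\<not> padic_null CARD('p) X"
  obtain r M where r: "r > 0" "\<And>n. n \<ge> M \<Longrightarrow> rat_padic_abs CARD('p) (X n) = r"
    using padic_Cauchy_nonnull[OF prime_card C nn] by metis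
  have "\<forall>\<^sub>F n in sequentially. rat_padic_abs CARD('p) (inverse (X n) * X n - 1) = 0"
    using eventually_ge_at_top[of M]
  proof eventually_elim
    case (elim n)
    hence "X n \<noteq> 0" using r(1) r(2)[of n] by auto
    thus ?case by simp
  qed
  hence "padic_null CARD('p) (\<lambda>n. inverse (X n) * X n - 1)"
    unfolding padic_null_def by (rule tendsto_eventually)
  thus "padic_null CARD('p)
     (\<lambda>n. (if padic_null CARD('p) X then \<lambda>_. 0 else (\<lambda>n. inverse (X n))) n * X n - 1)"
    using nn by simp
qed

quotient_type 'p padic = "'p::prime_card padic_Cauchy_seq" / padic_rel
  by (rule equivp_padic_rel)

instantiation padic :: (prime_card) field
begin

lift_definition zero_padic :: "'a padic" is 0 .

lift_definition one_padic :: "'a padic" is 1 .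

lift_definition plus_padic :: "'a padic \<Rightarrow> 'a padic \<Rightarrow> 'a padic" is "(+)"
  unfolding padic_rel_def using padic_null_seq_add by (fastforce simp: algebra_simps)

lift_definition uminus_padic :: "'a padic \<Rightarrow> 'a padic" is uminus
  unfolding padic_rel_def using padic_null_seq_minus by fastforce

lift_definition minus_padic :: "'a padic \<Rightarrow> 'a padic \<Rightarrow> 'a padic" is "(-)"
proof -
  fix X X' Y Y' :: "'a padic_Cauchy_seq"
  assume "padic_rel X X'" "padic_rel Y Y'"
  thus "padic_rel (X - Y) (X' - Y')"
    using padic_null_seq_add[of "X - X'" "- (Y - Y')"] padic_null_seq_minus[of "Y - Y'"]
    by (simp add: padic_rel_def algebra_simps)
qed

lift_definition times_padic :: "'a padic \<Rightarrow> 'a padic \<Rightarrow> 'a padic" is "(*)"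
proof -
  fix X X' Y Y' :: "'a padic_Cauchy_seq"
  assume "padic_rel X X'" "padic_rel Y Y'"
  hence "padic_null_seq (X * (Y - Y') + Y' * (X - X'))"
    by (intro padic_null_seq_add padic_null_seq_mult) (auto simp: padic_rel_def)
  thus "padic_rel (X * Y) (X' * Y')" by (simp add: padic_rel_def algebra_simps)
qed

lift_definition inverse_padic :: "'a padic \<Rightarrow> 'a padic" is padic_seq_inverse
proof -
  fix X Y :: "'a padic_Cauchy_seq"
  assume a: "padic_rel X Y"
  show "padic_rel (padic_seq_inverse X) (padic_seq_inverse Y)"
  proof (cases "padic_null_seq X")
    case True
    thus ?thesis using padic_rel_null[OF a] by (simp add: padic_seq_inverse_null padic_rel_def)
  next
    case False
    let ?X = "padic_seq_inverse X" and ?Y = "padic_seq_inverse Y"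
    have "padic_null_seq (?X * X - 1)" "padic_null_seq (?Y * Y - 1)" "padic_null_seq (X - Y)"
      using False a padic_rel_null[OF a] padic_seq_inverse_mult by (auto simp: padic_rel_def)
    hence "padic_null_seq (?Y * (?X * X - 1) + - (?X * (?Y * Y - 1)) + - (?X * ?Y * (X - Y)))"
      by (intro padic_null_seq_add padic_null_seq_minus padic_null_seq_mult)
    also have "?Y * (?X * X - 1) + - (?X * (?Y * Y - 1)) + - (?X * ?Y * (X - Y)) = ?X - ?Y"
      by (simp add: algebra_simps)
    finally show ?thesis by (simp add: padic_rel_def)
  qed
qed

definition divide_padic :: "'a padic \<Rightarrow> 'a padic \<Rightarrow> 'a padic" where
  "divide_padic x y = x * inverse y"

instance
proof
  fix a b c :: "'a padic"
  show "a + b + c = a + (b + c)" by transfer (simp add: padic_rel_def algebra_simps)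
  show "a + b = b + a" by transfer (simp add: padic_rel_def)
  show "0 + a = a" by transfer (simp add: padic_rel_def)
  show "- a + a = 0" by transfer (simp add: padic_rel_def)
  show "a - b = a + - b" by transfer (simp add: padic_rel_def)
  show "a * b * c = a * (b * c)" by transfer (simp add: padic_rel_def algebra_simps)
  show "a * b = b * a" by transfer (simp add: padic_rel_def algebra_simps)
  show "1 * a = a" by transfer (simp add: padic_rel_def)
  show "(a + b) * c = a * c + b * c" by transfer (simp add: padic_rel_def algebra_simps)
  have "\<not> padic_null_seq (1 :: 'a padic_Cauchy_seq)"
    by transfer (simp add: padic_null_def prime_card LIMSEQ_const_iff)
  thus "(0 :: 'a padic) \<noteq> 1"
    using padic_null_seq_minus[of "- 1 :: 'a padic_Cauchy_seq"]
    by transfer (auto simp: padic_rel_def)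
  show "inverse (0 :: 'a padic) = 0"
    by transfer (simp add: padic_rel_def padic_seq_inverse_null)
  show "a div b = a * inverse b" by (simp add: divide_padic_def)
  show "inverse a * a = 1" if "a \<noteq> 0"
    using that by transfer (rule padic_seq_inverse_mult, simp add: padic_rel_def)
qed

end

lift_definition padic_seq_abs :: "'p::prime_card padic_Cauchy_seq \<Rightarrow> real" is
  "\<lambda>X. lim (\<lambda>n. rat_padic_abs CARD('p) (X n))" .

lift_definition padic_abs :: "'p::prime_card padic \<Rightarrow> real" is padic_seq_abs
  unfolding padic_rel_def
proof transfer
  fix X Y :: "nat \<Rightarrow> rat"
  assume Y: "padic_Cauchy CARD('p) Y" and null: "padic_null CARD('p) (\<lambda>n. X n - Y n)"
  note p = prime_card[where 'a = 'p]
  let ?v = "rat_padic_abs CARD('p)"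
  have n: "(\<lambda>n. ?v (X n - Y n)) \<longlonglongrightarrow> 0" using null by (simp add: padic_null_def)
  have le: "\<bar>?v (X n) - ?v (Y n)\<bar> \<le> ?v (X n - Y n)" for n
    using rat_padic_abs_triangle[OF p, of "X n - Y n" "Y n"]
      rat_padic_abs_triangle[OF p, of "Y n - X n" "X n"]
      rat_padic_abs_minus_commute[OF p, of "X n" "Y n"]
    by simp
  have "(\<lambda>n. ?v (X n) - ?v (Y n)) \<longlonglongrightarrow> 0"
    by (rule Lim_null_comparison[OF _ n]) (simp add: le)
  moreover have "(\<lambda>n. ?v (Y n)) \<longlonglongrightarrow> lim (\<lambda>n. ?v (Y n))"
    using padic_Cauchy_convergent_abs[OF p Y] by (simp add: convergent_LIMSEQ_iff)
  ultimately have "(\<lambda>n. ?v (X n) - ?v (Y n) + ?v (Y n)) \<longlonglongrightarrow> 0 + lim (\<lambda>n. ?v (Y n))"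
    by (rule tendsto_add)
  thus "lim (\<lambda>n. ?v (X n)) = lim (\<lambda>n. ?v (Y n))" by (auto intro: limI)
qed

lemma padic_seq_abs_mult: "padic_seq_abs (X * Y) = padic_seq_abs X * padic_seq_abs Y"
proof transfer
  fix X Y :: "nat \<Rightarrow> rat"
  assume X: "padic_Cauchy CARD('a) X" and Y: "padic_Cauchy CARD('a) Y"
  note p = prime_card[where 'a = 'a]
  let ?v = "rat_padic_abs CARD('a)"
  have "(\<lambda>n. ?v (X n) * ?v (Y n)) \<longlonglongrightarrow> lim (\<lambda>n. ?v (X n)) * lim (\<lambda>n. ?v (Y n))"
    using padic_Cauchy_convergent_abs[OF p X] padic_Cauchy_convergent_abs[OF p Y]
    by (intro tendsto_mult) (simp_all add: convergent_LIMSEQ_iff)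
  thus "lim (\<lambda>n. ?v (X n * Y n)) = lim (\<lambda>n. ?v (X n)) * lim (\<lambda>n. ?v (Y n))"
    by (simp add: rat_padic_abs_mult[OF p] limI)
qed

lemma padic_abs_mult: "padic_abs (x * y) = padic_abs x * padic_abs y"
  by transfer (rule padic_seq_abs_mult)

lemma padic_seq_abs_eq_0: "padic_seq_abs X = 0 \<longleftrightarrow> padic_null_seq X"
proof transfer
  fix X :: "nat \<Rightarrow> rat"
  assume X: "padic_Cauchy CARD('a) X"
  have "(\<lambda>n. rat_padic_abs CARD('a) (X n)) \<longlonglongrightarrow> lim (\<lambda>n. rat_padic_abs CARD('a) (X n))"
    using padic_Cauchy_convergent_abs[OF prime_card X] by (simp add: convergent_LIMSEQ_iff)
  thus "lim (\<lambda>n. rat_padic_abs CARD('a) (X n)) = 0 \<longleftrightarrow> padic_null CARD('a) X"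
    unfolding padic_null_def by (auto dest: limI)
qed

lemma padic_abs_eq_0_iff [simp]: "padic_abs x = 0 \<longleftrightarrow> x = 0"
  by transfer (simp add: padic_seq_abs_eq_0 padic_rel_def)

lemma padic_abs_nonneg [simp]: "padic_abs x \<ge> 0"
proof transfer
  fix X :: "'a padic_Cauchy_seq"
  show "padic_seq_abs X \<ge> 0"
  proof transfer
    fix X :: "nat \<Rightarrow> rat"
    assume X: "padic_Cauchy CARD('a) X"
    have "(\<lambda>n. rat_padic_abs CARD('a) (X n)) \<longlonglongrightarrow> lim (\<lambda>n. rat_padic_abs CARD('a) (X n))"
      using padic_Cauchy_convergent_abs[OF prime_card X] by (simp add: convergent_LIMSEQ_iff)
    thus "lim (\<lambda>n. rat_padic_abs CARD('a) (X n)) \<ge> 0"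
      by (rule LIMSEQ_le_const) auto
  qed
qed

lemma padic_abs_of_int:
  "padic_abs (of_int k :: 'p::prime_card padic) = rat_padic_abs CARD('p) (of_int k)"
proof -
  have of_int_seq: "Rep_padic_Cauchy_seq (of_int k :: 'p padic_Cauchy_seq) = (\<lambda>_. of_int k)"
  proof (induction k rule: int_induct[of _ 0])
    case base
    show ?case by (simp add: zero_padic_Cauchy_seq.rep_eq)
  next
    case (step1 i)
    thus ?case by (simp add: plus_padic_Cauchy_seq.rep_eq one_padic_Cauchy_seq.rep_eq)
  next
    case (step2 i)
    thus ?case by (simp add: minus_padic_Cauchy_seq.rep_eq one_padic_Cauchy_seq.rep_eq)
  qed
  have "abs_padic (of_int k) = (of_int k :: 'p padic)"
  proof (induction k rule: int_induct[of _ 0])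
    case base
    show ?case by (simp add: zero_padic_def)
  next
    case (step1 i)
    thus ?case by (simp add: one_padic_def flip: plus_padic.abs_eq)
  next
    case (step2 i)
    thus ?case by (simp add: one_padic_def flip: minus_padic.abs_eq)
  qed
  hence "padic_abs (of_int k :: 'p padic) = padic_seq_abs (of_int k :: 'p padic_Cauchy_seq)"
    by (metis padic_abs.abs_eq)
  also have "\<dots> = rat_padic_abs CARD('p) (of_int k)"
    by (simp add: padic_seq_abs.rep_eq of_int_seq limI)
  finally show ?thesis .
qed


section \<open>The projective line over the p-adic numbers\<close>

definition proj_rel :: "'p::prime_card padic ^ 2 \<Rightarrow> 'p padic ^ 2 \<Rightarrow> bool" where
  "proj_rel u v \<longleftrightarrow> u \<noteq> 0 \<and> v \<noteq> 0 \<and> (\<exists>c. c \<noteq> 0 \<and> v = c *s u)"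

lemma part_equivp_proj_rel: "part_equivp (proj_rel :: 'p::prime_card padic ^ 2 \<Rightarrow> _)"
proof (rule part_equivpI)
  have "proj_rel (axis 1 1) (axis 1 1 :: 'p padic ^ 2)"
    unfolding proj_rel_def by (auto simp: axis_eq_0_iff intro!: exI[of _ 1])
  thus "\<exists>x :: 'p padic ^ 2. proj_rel x x" ..
  show "symp (proj_rel :: 'p padic ^ 2 \<Rightarrow> _)"
  proof (rule sympI)
    fix u v :: "'p padic ^ 2"
    assume "proj_rel u v"
    then obtain c where c: "u \<noteq> 0" "v \<noteq> 0" "c \<noteq> 0" "v = c *s u" by (auto simp: proj_rel_def)
    hence "u = inverse c *s v" by simp
    thus "proj_rel v u" using c unfolding proj_rel_def by (metis nonzero_imp_inverse_nonzero)
  qed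
  show "transp (proj_rel :: 'p padic ^ 2 \<Rightarrow> _)"
  proof (rule transpI)
    fix u v w :: "'p padic ^ 2"
    assume "proj_rel u v" "proj_rel v w"
    then obtain c d where "u \<noteq> 0" "w \<noteq> 0" "c \<noteq> 0" "d \<noteq> 0" "v = c *s u" "w = d *s v"
      by (auto simp: proj_rel_def)
    thus "proj_rel u w" unfolding proj_rel_def by (metis vector_smult_assoc mult_eq_0_iff)
  qed
qed

quotient_type 'p padic_proj_line = "'p::prime_card padic ^ 2" / partial: proj_rel
  by (rule part_equivp_proj_rel)

definition cf_matrix :: "nat \<Rightarrow> 'p::prime_card padic ^ 2 ^ 2" where
  "cf_matrix a = vector [vector [0, 1], vector [1, of_nat a]]"

lemma cf_matrix_mult: "cf_matrix a *v q = vector [q $ 2, q $ 1 + of_nat a * q $ 2]"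
  by (simp add: cf_matrix_def vec_eq_iff matrix_vector_mult_def forall_2 sum_2)

lift_definition cf_act :: "nat \<Rightarrow> 'p::prime_card padic_proj_line \<Rightarrow> 'p padic_proj_line" is
  "\<lambda>a q. cf_matrix a *v q"
proof -
  fix a and u v :: "'p padic ^ 2"
  assume "proj_rel u v"
  then obtain c where c: "u \<noteq> 0" "v \<noteq> 0" "c \<noteq> 0" "v = c *s u" by (auto simp: proj_rel_def)
  have nz: "cf_matrix a *v q \<noteq> 0" if "q \<noteq> 0" for q :: "'p padic ^ 2"
    using that by (auto simp: cf_matrix_mult vec_eq_iff forall_2)
  have "cf_matrix a *v v = c *s (cf_matrix a *v u)"
    unfolding c(4) by (simp add: cf_matrix_mult vec_eq_iff forall_2 algebra_simps)
  thus "proj_rel (cf_matrix a *v u) (cf_matrix a *v v)"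
    using c nz unfolding proj_rel_def by blast
qed

lift_definition is_PBad :: "real \<Rightarrow> 'p::prime_card padic_proj_line \<Rightarrow> bool" is
  "\<lambda>\<epsilon> q. \<forall>a b :: int. (a, b) \<noteq> (0, 0) \<longrightarrow>
     padic_abs (of_int a * q $ 1 + of_int b * q $ 2) / max (padic_abs (q $ 1)) (padic_abs (q $ 2))
       \<ge> \<epsilon> / real_of_int (max (a\<^sup>2) (b\<^sup>2))"
proof -
  fix \<epsilon> :: real and u v :: "'p padic ^ 2"
  assume "proj_rel u v"
  then obtain c where c: "c \<noteq> 0" "v = c *s u" by (auto simp: proj_rel_def)
  have "padic_abs (of_int a * v $ 1 + of_int b * v $ 2) / max (padic_abs (v $ 1)) (padic_abs (v $ 2)) =
    padic_abs (of_int a * u $ 1 + of_int b * u $ 2) / max (padic_abs (u $ 1)) (padic_abs (u $ 2))" for a b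
  proof -
    have "of_int a * v $ 1 + of_int b * v $ 2 = c * (of_int a * u $ 1 + of_int b * u $ 2)"
      using c(2) by (simp add: algebra_simps)
    moreover have "max (padic_abs (v $ 1)) (padic_abs (v $ 2)) =
      padic_abs c * max (padic_abs (u $ 1)) (padic_abs (u $ 2))"
      using c(2) by (simp add: padic_abs_mult max_mult_distrib_left)
    ultimately show ?thesis using c(1) by (simp add: padic_abs_mult)
  qed
  thus "(\<forall>a b :: int. (a, b) \<noteq> (0, 0) \<longrightarrow>
     padic_abs (of_int a * u $ 1 + of_int b * u $ 2) / max (padic_abs (u $ 1)) (padic_abs (u $ 2))
       \<ge> \<epsilon> / real_of_int (max (a\<^sup>2) (b\<^sup>2))) =
    (\<forall>a b :: int. (a, b) \<noteq> (0, 0) \<longrightarrow>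
     padic_abs (of_int a * v $ 1 + of_int b * v $ 2) / max (padic_abs (v $ 1)) (padic_abs (v $ 2))
       \<ge> \<epsilon> / real_of_int (max (a\<^sup>2) (b\<^sup>2)))" by simp
qed

definition PBad :: "real \<Rightarrow> 'p::prime_card padic_proj_line set" where
  "PBad \<epsilon> = {q. is_PBad \<epsilon> q}"


section \<open>Words\<close>

text \<open>The letter a_1 of the infinite word w = a_1 a_2 ... is \<open>w 0\<close>.\<close>

definition words_upto :: "nat \<Rightarrow> nat word set" where
  "words_upto N = {w. \<forall>i. w i \<in> {1..N}}"

definition occurrences :: "'a word \<Rightarrow> 'a list \<Rightarrow> nat set" where
  "occurrences w u = {i. subsequence w i (i + length u) = u}"

definition is_factor :: "'a word \<Rightarrow> 'a list \<Rightarrow> bool" where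
  "is_factor w u \<longleftrightarrow> occurrences w u \<noteq> {}"

definition uniformly_recurrent :: "'a word \<Rightarrow> bool" where
  "uniformly_recurrent w \<longleftrightarrow>
     (\<forall>u. is_factor w u \<longrightarrow>
        infinite (occurrences w u) \<and>
        (\<exists>L. \<forall>i\<in>occurrences w u. \<forall>j\<in>occurrences w u.
           i < j \<and> {i<..<j} \<inter> occurrences w u = {} \<longrightarrow> j - i \<le> L))"

definition periodic_word :: "'a word \<Rightarrow> bool" where
  "periodic_word w \<longleftrightarrow> (\<exists>k>0. suffix k w = w)"


section \<open>The bipartite factor graphs\<close>

definition factors :: "'a word \<Rightarrow> nat \<Rightarrow> 'a list set" where
  "factors w n = {u. length u = n \<and> is_factor w u}"

text \<open>The two copies of the set of factors are tagged with \<open>Inl\<close> and \<open>Inr\<close>.\<close>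

definition factor_graph_verts :: "'a word \<Rightarrow> nat \<Rightarrow> ('a list + 'a list) set" where
  "factor_graph_verts w n = factors w n <+> factors w n"

definition factor_graph_edges :: "'a word \<Rightarrow> nat \<Rightarrow> (('a list + 'a list) \<times> ('a list + 'a list)) set" where
  "factor_graph_edges w n =
     {(Inl s, Inr t) | s t. s \<in> factors w n \<and> t \<in> factors w n \<and> is_factor w (s @ t)}"

text \<open>Connected components of the undirected graph underlying \<open>E\<close>, as sets of vertices.\<close>

definition connected_components :: "'v set \<Rightarrow> ('v \<times> 'v) set \<Rightarrow> 'v set set" where
  "connected_components V E = V // {(x, y). x \<in> V \<and> y \<in> V \<and> (x, y) \<in> (E \<union> E\<inverse>)\<^sup>*}"


section \<open>The set LMad\<close>

definition word_proj_shift ::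
  "nat word \<times> 'p::prime_card padic_proj_line \<Rightarrow> nat word \<times> 'p padic_proj_line" where
  "word_proj_shift = (\<lambda>(w, q). (suffix 1 w, cf_act (w 0) q))"

definition LMad_eps :: "real \<Rightarrow> (nat word \<times> 'p::prime_card padic_proj_line) set" where
  "LMad_eps \<epsilon> =
     {wx. \<forall>n. (word_proj_shift ^^ n) wx \<in> words_upto (nat \<lfloor>inverse \<epsilon>\<rfloor> + 1) \<times> PBad \<epsilon>}"

definition LMad :: "(nat word \<times> 'p::prime_card padic_proj_line) set" where
  "LMad = (\<Union>\<epsilon>\<in>{0<..}. LMad_eps \<epsilon>)"

end

theory Submission
  imports Defs
begin

text \<open>
  Write \<open>q\<^sub>n\<close> for the point reached after \<open>n\<close> letters. Modulo \<open>p\<^sup>k\<close> it is the state of a finite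
  automaton driven by \<open>w\<close>, all of whose transitions are injective. Uniform recurrence makes the set
  of states seen at the occurrences of a factor \<open>u\<close> of constant size for long \<open>u\<close>, so it is
  already determined by a short prefix of \<open>u\<close>, and, pushed to the end of \<open>u\<close>, by a short suffix.
  Hence it is constant on the connected components of the factor graph, and takes at most \<open>C\<close> values
  for every \<open>k\<close>. Consequently there are infinitely many positions \<open>i < j\<^sub>1 < j\<^sub>2 < \<dots>\<close> at which these
  sets of states agree for all \<open>k\<close> simultaneously.

  If \<open>u\<close> is the factor between two such positions, then all iterates of \<open>q\<^sub>i\<close> under the matrix of \<open>u\<close>
  are badly approximable with the same constant. A power \<open>E\<close> of this matrix is congruent to the
  identity modulo \<open>p\<^sup>2\<close>, and then \<open>m \<mapsto> E\<^sup>m q\<^sub>i\<close> is a similarity for the \<open>p\<close>-adic metric. So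
  unless \<open>E\<close> fixes \<open>q\<^sub>i\<close>, the orbit is dense in a ball and approaches a rational point, which is
  impossible. Integer matrices with a common irrational fixed point commute, and the matrices of
  continued fraction letters generate a free monoid, so powers of the prefixes of \<open>a\<^sub>i a\<^sub>i\<^sub>+\<^sub>1 \<dots>\<close> ending
  at the \<open>j\<^sub>l\<close> commute as words. This forces periodicity.
\<close>

section \<open>The p-adic absolute value\<close>

text \<open>\<open>padic_abs\<close> is defined through \<open>lim\<close>; convergence along Cauchy
  sequences makes it a genuine limit, so inequalities pass over from the rationals.\<close>

lemma padic_abs_abs_padic_LIMSEQ:
  fixes X :: "'p::prime_card padic_Cauchy_seq"
  shows "(\<lambda>n. rat_padic_abs CARD('p) (Rep_padic_Cauchy_seq X n)) \<longlonglongrightarrow> padic_abs (abs_padic X)"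
proof -
  have "padic_Cauchy CARD('p) (Rep_padic_Cauchy_seq X)"
    using Rep_padic_Cauchy_seq by blast
  from padic_Cauchy_convergent_abs[OF prime_card this] show ?thesis
    by (simp add: padic_abs.abs_eq padic_seq_abs.rep_eq convergent_LIMSEQ_iff)
qed

lemma padic_abs_ultra: "padic_abs (x + y) \<le> max (padic_abs x) (padic_abs y)"
  for x y :: "'p::prime_card padic"
proof -
  obtain X Y where XY: "x = abs_padic X" "y = abs_padic Y"
    by (metis Quotient_abs_rep[OF Quotient_padic])
  have "(\<lambda>n. max (rat_padic_abs CARD('p) (Rep_padic_Cauchy_seq X n))
      (rat_padic_abs CARD('p) (Rep_padic_Cauchy_seq Y n))) \<longlonglongrightarrow> max (padic_abs x) (padic_abs y)"
    unfolding XY by (intro tendsto_max padic_abs_abs_padic_LIMSEQ)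
  moreover have "(\<lambda>n. rat_padic_abs CARD('p) (Rep_padic_Cauchy_seq (X + Y) n)) \<longlonglongrightarrow> padic_abs (x + y)"
    unfolding XY plus_padic.abs_eq by (rule padic_abs_abs_padic_LIMSEQ)
  ultimately show ?thesis
    using rat_padic_abs_ultra[OF prime_card[where 'a = 'p]]
    by (intro LIMSEQ_le[of _ "padic_abs (x + y)"]) (auto simp: plus_padic_Cauchy_seq.rep_eq)
qed

lemma padic_abs_1 [simp]: "padic_abs (1 :: 'p::prime_card padic) = 1"
  using padic_abs_of_int[of 1, where 'p = 'p] by (simp add: prime_card)

lemma padic_abs_0 [simp]: "padic_abs (0 :: 'p::prime_card padic) = 0"
  by simp

lemma padic_abs_minus [simp]: "padic_abs (- x) = padic_abs x" for x :: "'p::prime_card padic"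
proof -
  have "padic_abs (- 1 :: 'p padic) = 1"
    using padic_abs_of_int[of "- 1", where 'p = 'p] by (simp add: prime_card)
  thus ?thesis using padic_abs_mult[of "- 1" x] by simp
qed

lemma padic_abs_ultra_diff: "padic_abs (x - y) \<le> max (padic_abs x) (padic_abs y)"
  for x y :: "'p::prime_card padic"
  using padic_abs_ultra[of x "- y"] by simp

lemma padic_abs_add_le:
  "padic_abs x \<le> r \<Longrightarrow> padic_abs y \<le> r \<Longrightarrow> padic_abs (x + y) \<le> r"
  for x y :: "'p::prime_card padic"
  using padic_abs_ultra[of x y] by simp

lemma padic_abs_diff_le:
  "padic_abs x \<le> r \<Longrightarrow> padic_abs y \<le> r \<Longrightarrow> padic_abs (x - y) \<le> r"
  for x y :: "'p::prime_card padic"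
  using padic_abs_ultra_diff[of x y] by simp

lemma padic_abs_divide: "padic_abs (x / y) = padic_abs x / padic_abs y"
  for x y :: "'p::prime_card padic"
proof (cases "y = 0")
  case False
  have "padic_abs (x / y) * padic_abs y = padic_abs x"
    using False by (simp flip: padic_abs_mult)
  thus ?thesis using False by (simp add: field_simps)
qed auto

lemma padic_abs_add_eq:
  fixes x y :: "'p::prime_card padic"
  assumes "padic_abs x < padic_abs y"
  shows "padic_abs (x + y) = padic_abs y"
  using assms padic_abs_ultra[of x y] padic_abs_ultra_diff[of "x + y" x]
  by (simp add: max_def split: if_splits)

lemma padic_abs_of_int_eq:
  "k \<noteq> 0 \<Longrightarrow> padic_abs (of_int k :: 'p::prime_card padic) = 1 / real CARD('p) ^ multiplicity (int CARD('p)) k"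
  by (simp add: padic_abs_of_int rat_padic_abs_of_int prime_card)

lemma real_card_gt_1: "real CARD('p::prime_card) > 1"
  using prime_gt_1_nat[OF prime_card[where 'a = 'p]] by simp

lemma padic_abs_of_int_le_iff:
  "padic_abs (of_int k :: 'p::prime_card padic) \<le> 1 / real CARD('p) ^ j \<longleftrightarrow> int CARD('p) ^ j dvd k"
proof (cases "k = 0")
  case False
  have "\<not> is_unit (int CARD('p))" using prime_card[where 'a='p]
    by (metis not_prime_unit prime_int_nat_transfer prime_nat_int_transfer)
  hence "int CARD('p) ^ j dvd k \<longleftrightarrow> j \<le> multiplicity (int CARD('p)) k"
    using False by (simp add: power_dvd_iff_le_multiplicity)
  moreover have "1 / real CARD('p) ^ multiplicity (int CARD('p)) k \<le> 1 / real CARD('p) ^ j \<longleftrightarrow>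
      j \<le> multiplicity (int CARD('p)) k"
    using real_card_gt_1[where 'p='p] by (simp add: field_simps)
  ultimately show ?thesis using False by (simp add: padic_abs_of_int_eq)
qed auto

lemma padic_abs_of_int_le_1: "padic_abs (of_int k :: 'p::prime_card padic) \<le> 1"
  using padic_abs_of_int_le_iff[of k 0, where 'p='p] by simp

lemma padic_abs_of_int_eq_1:
  assumes "\<not> int CARD('p) dvd k"
  shows "padic_abs (of_int k :: 'p::prime_card padic) = 1"
proof -
  have "k \<noteq> 0" using assms by auto
  thus ?thesis using assms by (simp add: padic_abs_of_int_eq not_dvd_imp_multiplicity_0)
qed

lemma padic_abs_card: "padic_abs (of_nat CARD('p) :: 'p::prime_card padic) = 1 / real CARD('p)"
  using padic_abs_of_int_eq[of "int CARD('p)", where 'p='p] prime_card[where 'a='p]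
  by (simp add: prime_gt_0_nat)

text \<open>A denominator divisible by p would force absolute value at least p, so it is invertible
  modulo \<open>p ^ j\<close>; \<open>c\<close> is the numerator times this inverse, reduced to a
  residue.\<close>

lemma rat_padic_integer_approx:
  assumes p: "prime p" and "rat_padic_abs p q \<le> 1"
  obtains c :: int where "0 \<le> c" "c < int p ^ j" "rat_padic_abs p (q - of_int c) \<le> 1 / real p ^ j"
proof -
  have p1: "p > 1" using p by (rule prime_gt_1_nat)
  have "\<exists>c::int. 0 \<le> c \<and> c < int p ^ j \<and> rat_padic_abs p (q - of_int c) \<le> 1 / real p ^ j"
  proof (cases "q = 0")
    case True
    thus ?thesis using p1 by (intro exI[of _ 0]) auto
  next
    case False
    obtain a b where ab: "quotient_of q = (a, b)" by fastforce
    have q: "q = of_int a / of_int b" by (rule quotient_of_div[OF ab])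
    have b0: "b \<noteq> 0" using quotient_of_denom_pos[OF ab] by simp
    have a0: "a \<noteq> 0" using False q by auto
    have cop: "coprime a b" by (rule quotient_of_coprime[OF ab])
    have nd: "\<not> int p dvd b"
    proof
      assume d: "int p dvd b"
      hence "\<not> int p dvd a" using cop p
        by (meson coprime_common_divisor not_prime_unit prime_nat_int_transfer)
      hence "multiplicity (int p) a = 0" by (rule not_dvd_imp_multiplicity_0)
      moreover have "multiplicity (int p) b \<ge> 1"
        using d b0 p1 by (intro multiplicity_geI) (auto simp: )
      ultimately have "rat_padic_abs p q \<ge> real p powi 1"
        using rat_padic_abs_frac[OF p a0 b0] q p1 by (simp add: power_int_increasing self_le_power)
      thus False using assms(2) p1 by simp
    qed
    hence "coprime b (int p ^ j)"
      using p
      by (metis coprime_commute coprime_power_right_iff prime_imp_coprime prime_nat_int_transfer coprime_power_left_iff)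
    then obtain e where e: "[b * e = 1] (mod int p ^ j)"
      by (meson cong_solve_coprime_int)
    define c where "c = a * e mod int p ^ j"
    have c: "0 \<le> c" "c < int p ^ j" using p1 by (auto simp: c_def)
    have "[b * c = a * (b * e)] (mod int p ^ j)" unfolding c_def
      by (simp add: cong_def mod_mult_right_eq ac_simps)
    also have "[a * (b * e) = a * 1] (mod int p ^ j)" using e by (rule cong_scalar_left)
    finally have "int p ^ j dvd a - b * c" by (simp add: cong_iff_dvd_diff dvd_diff_commute)
    have eq: "q - of_int c = of_int (a - b * c) / of_int b" using b0 by (simp add: q field_simps)
    have "rat_padic_abs p (q - of_int c) \<le> 1 / real p ^ j"
    proof (cases "a - b * c = 0")
      case True
      thus ?thesis using eq p1 by simp
    next
      case nz: False
      have "multiplicity (int p) b = 0" using nd by (rule not_dvd_imp_multiplicity_0)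
      moreover have "multiplicity (int p) (a - b * c) \<ge> j"
        using \<open>int p ^ j dvd a - b * c\<close> nz p1 by (intro multiplicity_geI) auto
      ultimately show ?thesis unfolding eq rat_padic_abs_frac[OF p nz b0] using p1
        by (simp add: power_int_minus field_simps)
    qed
    thus ?thesis using c by blast
  qed
  thus ?thesis using that by blast
qed

text \<open>Approximate a late term of a representing Cauchy sequence; the estimate survives the
  limit.\<close>

lemma padic_integer_approx:
  fixes x :: "'p::prime_card padic"
  assumes "padic_abs x \<le> 1"
  obtains c :: int where "0 \<le> c" "c < int CARD('p) ^ j"
    "padic_abs (x - of_int c) \<le> 1 / real CARD('p) ^ j"
proof -
  note p = prime_card[where 'a = 'p]
  let ?v = "rat_padic_abs CARD('p)"
  obtain X where X: "x = abs_padic X" by (metis Quotient_abs_rep[OF Quotient_padic])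
  define Y where "Y = Rep_padic_Cauchy_seq X"
  have Y: "padic_Cauchy CARD('p) Y" using Rep_padic_Cauchy_seq unfolding Y_def by blast
  have lim: "(\<lambda>n. ?v (Y n)) \<longlonglongrightarrow> padic_abs x"
    unfolding Y_def X by (rule padic_abs_abs_padic_LIMSEQ)
  \<comment> \<open>Convergence to a limit of size 1 alone would not bound the terms by 1; outside
    the null case the absolute values are eventually constant.\<close>
  have ev: "eventually (\<lambda>n. ?v (Y n) \<le> 1) sequentially"
  proof (cases "padic_null CARD('p) Y")
    case True
    hence "eventually (\<lambda>n. ?v (Y n) < 1) sequentially"
      unfolding padic_null_def by (rule order_tendstoD) simp
    thus ?thesis by (rule eventually_mono) simp
  next
    case False
    then obtain r M where r: "\<And>n. n \<ge> M \<Longrightarrow> ?v (Y n) = r"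
      using padic_Cauchy_nonnull[OF p Y] by metis
    hence "eventually (\<lambda>n. ?v (Y n) = r) sequentially"
      by (auto simp: eventually_sequentially)
    moreover from this have "(\<lambda>n. ?v (Y n)) \<longlonglongrightarrow> r" by (rule tendsto_eventually)
    hence "r = padic_abs x" using lim LIMSEQ_unique by blast
    ultimately show ?thesis using assms by (auto elim: eventually_mono)
  qed
  have e: "1 / real CARD('p) ^ j > 0" using real_card_gt_1[where 'p='p] by simp
  obtain M where M: "\<And>m n. m \<ge> M \<Longrightarrow> n \<ge> M \<Longrightarrow> ?v (Y m - Y n) < 1 / real CARD('p) ^ j"
    using padic_CauchyD[OF Y e] by blast
  obtain M' where M': "\<And>n. n \<ge> M' \<Longrightarrow> ?v (Y n) \<le> 1"
    using ev by (auto simp: eventually_sequentially)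
  define m where "m = max M M'"
  obtain c :: int where c: "0 \<le> c" "c < int CARD('p) ^ j"
    "?v (Y m - of_int c) \<le> 1 / real CARD('p) ^ j"
    using rat_padic_integer_approx[OF p M'[of m]] by (auto simp: m_def)
  have Rep_of_int: "Rep_padic_Cauchy_seq (of_int k :: 'p padic_Cauchy_seq) = (\<lambda>_. of_int k)" for k
    by (induction k rule: int_induct[of _ 0])
      (simp_all add: zero_padic_Cauchy_seq.rep_eq plus_padic_Cauchy_seq.rep_eq
        one_padic_Cauchy_seq.rep_eq minus_padic_Cauchy_seq.rep_eq)
  have abs_of_int: "abs_padic (of_int k) = (of_int k :: 'p padic)" for k
    by (induction k rule: int_induct[of _ 0])
      (simp_all add: zero_padic_def one_padic_def flip: plus_padic.abs_eq minus_padic.abs_eq)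
  have "x - of_int c = abs_padic (X - of_int c)"
    by (simp add: X minus_padic.abs_eq flip: abs_of_int)
  hence "(\<lambda>n. ?v (Y n - of_int c)) \<longlonglongrightarrow> padic_abs (x - of_int c)"
    using padic_abs_abs_padic_LIMSEQ[of "X - of_int c"]
    by (simp add: minus_padic_Cauchy_seq.rep_eq Rep_of_int Y_def)
  moreover have "?v (Y n - of_int c) \<le> 1 / real CARD('p) ^ j" if "n \<ge> m" for n
  proof -
    have "?v (Y n - of_int c) \<le> max (?v (Y n - Y m)) (?v (Y m - of_int c))"
      using rat_padic_abs_ultra[OF p, of "Y n - Y m" "Y m - of_int c"] by simp
    thus ?thesis using c(3) M[of n m] that by (simp add: m_def)
  qed
  ultimately have "padic_abs (x - of_int c) \<le> 1 / real CARD('p) ^ j"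
    by (intro LIMSEQ_le_const2) auto
  thus ?thesis using that c by blast
qed

section \<open>Orbits of integer matrices congruent to the identity\<close>

text \<open>The subsequence along multiples of j of a sequence annihilated by the characteristic
  polynomial of a matrix is annihilated by that of its j-th power.\<close>

lemma recurrence_multiple:
  fixes s :: "nat \<Rightarrow> 'a::comm_ring_1" and T D P :: int
  assumes rec: "\<And>i. s (i + 2) = of_int T * s (i + 1) - of_int D * s i"
    and T: "[T = 2] (mod P)" and D: "[D = 1] (mod P)"
  obtains T' where "[T' = 2] (mod P)"
    "\<And>i. s (i + 2 * j) = of_int T' * s (i + j) - of_int (D ^ j) * s i"
proof -
  define Q where "Q j T' \<longleftrightarrow> [T' = 2] (mod P) \<and>
    (\<forall>i. s (i + 2 * j) = of_int T' * s (i + j) - of_int (D ^ j) * s i)" for j T'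
  \<comment> \<open>Two consecutive indices are carried along because the traces of the powers
    satisfy the recurrence with coefficients \<open>T\<close> and \<open>D\<close>, starting with 2
    and \<open>T\<close>.\<close>
  have "\<exists>T0 T1. Q j T0 \<and> Q (Suc j) T1"
  proof (induction j)
    case 0
    show ?case using T rec by (intro exI[of _ 2] exI[of _ T]) (auto simp: Q_def)
  next
    case (Suc j)
    then obtain T0 T1 where Q: "Q j T0" "Q (Suc j) T1" by blast
    have "[T * T1 - D * T0 = 2 * 2 - 1 * 2] (mod P)"
      using Q T D by (intro cong_diff cong_mult) (auto simp: Q_def)
    moreover have "s (i + 2 * Suc (Suc j)) =
        of_int (T * T1 - D * T0) * s (i + Suc (Suc j)) - of_int (D ^ Suc (Suc j)) * s i" for i
    proof -
      have e0: "of_int T0 * s (i + 2 + j) = s (i + 2 + 2 * j) + of_int (D ^ j) * s (i + 2)"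
        using Q(1)[unfolded Q_def, THEN conjunct2, rule_format, of "i + 2"] by simp
      have e1: "of_int T1 * s (i + 1 + Suc j) = s (i + 1 + 2 * Suc j) + of_int (D ^ Suc j) * s (i + 1)"
        using Q(2)[unfolded Q_def, THEN conjunct2, rule_format, of "i + 1"] by simp
      have "of_int (T * T1 - D * T0) * s (i + Suc (Suc j)) =
          of_int T * (of_int T1 * s (i + 1 + Suc j)) - of_int D * (of_int T0 * s (i + 2 + j))"
        by (simp add: algebra_simps)
      also have "\<dots> = (of_int T * s (i + 2 + 2 * j + 1) - of_int D * s (i + 2 + 2 * j)) +
          of_int (D ^ Suc j) * (of_int T * s (i + 1) - s (i + 2))"
        unfolding e0 e1 by (simp add: algebra_simps)
      also have "\<dots> = s (i + 2 + 2 * j + 2) + of_int (D ^ Suc j) * (of_int D * s i)"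
        unfolding rec by simp
      finally show ?thesis by (simp add: algebra_simps)
    qed
    ultimately have "Q (Suc (Suc j)) (T * T1 - D * T0)" by (simp add: Q_def)
    thus ?case using Q by blast
  qed
  thus ?thesis using that unfolding Q_def by blast
qed

text \<open>The coefficients form the Lucas sequence of \<open>T\<close> and \<open>D\<close>, which
  is \<open>n\<close> itself for trace 2 and determinant 1.\<close>

lemma recurrence_coefficient:
  fixes s :: "nat \<Rightarrow> 'a::comm_ring_1" and T D P :: int
  assumes rec: "\<And>i. s (i + 2) = of_int T * s (i + 1) - of_int D * s i" and s0: "s 0 = 0"
    and T: "[T = 2] (mod P)" and D: "[D = 1] (mod P)"
  obtains b where "[b = int n] (mod P)" "s n = of_int b * s 1"
proof -
  have "\<exists>b0 b1. [b0 = int n] (mod P) \<and> [b1 = int (Suc n)] (mod P) \<and>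
    s n = of_int b0 * s 1 \<and> s (Suc n) = of_int b1 * s 1"
  proof (induction n)
    case 0
    show ?case using s0 by (intro exI[of _ 0] exI[of _ 1]) simp
  next
    case (Suc n)
    then obtain b0 b1 where b: "[b0 = int n] (mod P)" "[b1 = int (Suc n)] (mod P)"
      "s n = of_int b0 * s 1" "s (Suc n) = of_int b1 * s 1" by blast
    have "[T * b1 - D * b0 = 2 * int (Suc n) - 1 * int n] (mod P)"
      using b T D by (intro cong_diff cong_mult)
    moreover have "2 * int (Suc n) - 1 * int n = int (Suc (Suc n))" by simp
    moreover have "s (Suc (Suc n)) = of_int (T * b1 - D * b0) * s 1"
      using rec[of n] b by (simp add: algebra_simps)
    ultimately show ?case using b by metis
  qed
  thus ?thesis using that by blast
qed

text \<open>Factors p are split off \<open>n\<close> one at a time. Passing to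
  \<open>s (p * i)\<close> keeps the hypotheses, and the new first term is \<open>s 1\<close> times
  a coefficient congruent to p modulo p^2, hence divisible by p exactly once. When p does not divide
  \<open>n\<close>, the coefficient is a unit.\<close>

lemma padic_abs_recurrence:
  fixes s :: "nat \<Rightarrow> 'p::prime_card padic" and T D :: int
  defines "P \<equiv> (int CARD('p))\<^sup>2"
  assumes "\<And>i. s (i + 2) = of_int T * s (i + 1) - of_int D * s i" and "s 0 = 0"
    and "[T = 2] (mod P)" and "[D = 1] (mod P)"
  shows "padic_abs (s n) = padic_abs (of_nat n :: 'p padic) * padic_abs (s 1)"
  using assms(2-)
proof (induction n arbitrary: s T D rule: less_induct)
  case (less n)
  note rec = less.prems(1) and s0 = less.prems(2) and T = less.prems(3) and D = less.prems(4)
  let ?p = "CARD('p)"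
  have p1: "?p > 1" using prime_gt_1_nat[OF prime_card[where 'a='p]] .
  consider "n = 0" | "n \<noteq> 0" "?p dvd n" | "\<not> ?p dvd n" by blast
  thus ?case
  proof cases
    case 1
    thus ?thesis using s0 by simp
  next
    case 2
    then obtain m where m: "n = ?p * m" by blast
    with 2 p1 have mn: "m < n" "m \<noteq> 0" by auto
    obtain T' where T': "[T' = 2] (mod P)"
      "\<And>i. s (i + 2 * ?p) = of_int T' * s (i + ?p) - of_int (D ^ ?p) * s i"
      using recurrence_multiple[OF rec T D] by metis
    have "[D ^ ?p = 1 ^ ?p] (mod P)" using D by (rule cong_pow)
    hence D': "[D ^ ?p = 1] (mod P)" by simp
    have "padic_abs (s (?p * m)) = padic_abs (of_nat m :: 'p padic) * padic_abs (s (?p * 1))"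
    proof (rule less.IH[OF mn(1) _ _ T'(1) D'])
      show "s (?p * (i + 2)) = of_int T' * s (?p * (i + 1)) - of_int (D ^ ?p) * s (?p * i)" for i
        using T'(2)[of "?p * i"] by (simp add: algebra_simps mult_2_right)
    qed (simp add: s0)
    moreover obtain b where b: "[b = int ?p] (mod P)" "s ?p = of_int b * s 1"
      using recurrence_coefficient[OF rec s0 T D] by metis
    have pd: "int ?p dvd b"
    proof -
      have "[b = int ?p] (mod int ?p)"
        using b(1) unfolding P_def power2_eq_square by (meson cong_modulus_mult)
      thus ?thesis by (simp add: cong_dvd_iff)
    qed
    \<comment> \<open>Here the congruence modulo p^2, rather than p, matters.\<close>
    have npd: "\<not> (int ?p) ^ 2 dvd b"
    proof
      assume "(int ?p) ^ 2 dvd b"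
      hence "(int ?p) ^ 2 dvd int ?p" using b(1) unfolding P_def by (simp add: cong_dvd_iff)
      hence "int ?p ^ 2 \<le> int ?p" using p1 by (intro zdvd_imp_le) auto
      thus False using p1 by (simp add: power2_eq_square)
    qed
    have "padic_abs (of_int b :: 'p padic) = padic_abs (of_nat ?p :: 'p padic)"
    proof -
      have b0: "b \<noteq> 0" using npd by auto
      have "multiplicity (int ?p) b = 1"
        using pd npd by (intro multiplicity_eqI) (auto simp: power2_eq_square)
      thus ?thesis using b0 by (simp add: padic_abs_card padic_abs_of_int_eq)
    qed
    ultimately show ?thesis using b(2) by (simp add: m padic_abs_mult)
  next
    case 3
    obtain b where b: "[b = int n] (mod P)" "s n = of_int b * s 1"
      using recurrence_coefficient[OF rec s0 T D] by metis
    have "[b = int n] (mod int ?p)"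
      using b(1) unfolding P_def power2_eq_square by (meson cong_modulus_mult)
    hence "\<not> int ?p dvd b" using 3 by (simp add: cong_dvd_iff)
    hence "padic_abs (of_int b :: 'p padic) = 1" by (rule padic_abs_of_int_eq_1)
    moreover have "padic_abs (of_int (int n) :: 'p padic) = 1"
      using 3 by (intro padic_abs_of_int_eq_1) simp
    ultimately show ?thesis using b(2) by (simp add: padic_abs_mult)
  qed
qed

text \<open>In the affine coordinate \<open>Y m / Z m\<close> the orbit is a similar copy of the
  index set: the distance of the m-th and n-th ratios is \<open>|m - n| |\<omega>|\<close>. Hence
  the first \<open>p ^ k\<close> ratios meet every residue class of scale
  \<open>p ^ k \<omega>\<close> in the ball of radius \<open>|\<omega>|\<close> around the start, in
  particular that of an integer \<open>N\<close> in this ball.\<close>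

lemma padic_orbit_near_rational:
  fixes Y Z :: "nat \<Rightarrow> 'p::prime_card padic" and a b c d :: int
  defines "P \<equiv> (int CARD('p))\<^sup>2"
  assumes Y: "\<And>m. Y (Suc m) = of_int a * Y m + of_int b * Z m"
    and Z: "\<And>m. Z (Suc m) = of_int c * Y m + of_int d * Z m"
    and cong: "[a = 1] (mod P)" "[b = 0] (mod P)" "[c = 0] (mod P)" "[d = 1] (mod P)"
    and Z0: "padic_abs (Z 0) = 1" and Y0: "padic_abs (Y 0) \<le> 1"
    and not_fixed: "Y 0 * Z 1 - Y 1 * Z 0 \<noteq> 0"
  obtains N :: int where "\<And>k. \<exists>m. padic_abs (Y m - of_int N * Z m) \<le> 1 / real CARD('p) ^ k"
proof -
  let ?p = "CARD('p)"
  let ?v = "padic_abs :: 'p padic \<Rightarrow> real"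
  have p1: "?p > 1" using prime_gt_1_nat[OF prime_card[where 'a='p]] .
  have dvdP: "int ?p dvd P" by (simp add: P_def power2_eq_square)
  have pc: "int ?p dvd c" using cong(3) dvdP by (metis cong_0_iff dvd_trans)
  have nd: "\<not> int ?p dvd x" if "[x = 1] (mod P)" for x
  proof -
    have "[x = 1] (mod int ?p)" using that dvdP by (rule cong_dvd_modulus)
    thus ?thesis using p1 by (simp add: cong_dvd_iff)
  qed
  define T where "T = a + d"
  define D where "D = a * d - b * c"
  have "[T = 1 + 1] (mod P)" unfolding T_def using cong by (intro cong_add)
  hence T: "[T = 2] (mod P)" by simp
  have "[D = 1 * 1 - 0 * 0] (mod P)" unfolding D_def using cong by (intro cong_diff cong_mult)
  hence D: "[D = 1] (mod P)" by simp
  have vD: "?v (of_int D) = 1" by (rule padic_abs_of_int_eq_1[OF nd[OF D]])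
  have recY: "Y (i + 2) = of_int T * Y (i + 1) - of_int D * Y i" for i
    by (simp add: Y Z T_def D_def algebra_simps)
  have recZ: "Z (i + 2) = of_int T * Z (i + 1) - of_int D * Z i" for i
    by (simp add: Y Z T_def D_def algebra_simps)
  \<comment> \<open>p divides \<open>c\<close> while \<open>d\<close> is a unit, so \<open>Z\<close>
    keeps absolute value 1 and the ratios stay integral.\<close>
  have unit: "?v (Z m) = 1 \<and> ?v (Y m) \<le> 1" for m
  proof (induction m)
    case (Suc m)
    have "?v (of_int c) \<le> 1 / real ?p" using padic_abs_of_int_le_iff[of c 1, where 'p='p] pc by simp
    also have "\<dots> < 1" using p1 by simp
    finally have "?v (of_int c * Y m) < 1"
      using Suc by (simp add: padic_abs_mult) (metis mult_left_le padic_abs_nonneg le_less_trans)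
    moreover have "?v (of_int d * Z m) = 1"
      using Suc padic_abs_of_int_eq_1[OF nd[OF cong(4)]] by (simp add: padic_abs_mult)
    ultimately have "?v (Z (Suc m)) = 1" unfolding Z by (simp add: padic_abs_add_eq)
    moreover have "?v (Y (Suc m)) \<le> 1" unfolding Y
      using Suc padic_abs_of_int_le_1[where 'p='p]
      by (intro padic_abs_add_le) (simp_all add: padic_abs_mult mult_le_one)
    ultimately show ?case by simp
  qed (use Z0 Y0 in auto)
  have nz: "Z m \<noteq> 0" for m using unit[of m] by auto
  define \<zeta> where "\<zeta> m = Y m / Z m" for m
  define \<omega> where "\<omega> = Y 0 * Z 1 - Y 1 * Z 0"
  have \<omega>: "\<omega> \<noteq> 0" using not_fixed by (simp add: \<omega>_def)
  \<comment> \<open>Applying the matrix multiplies the wedge product by its determinant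
    \<open>D\<close>, a p-adic unit.\<close>
  have wedge_Suc: "?v (Y m * Z (Suc m) - Y (Suc m) * Z m) = ?v \<omega>" for m
  proof (induction m)
    case (Suc m)
    have "Y (Suc m) * Z (Suc (Suc m)) - Y (Suc (Suc m)) * Z (Suc m) =
        of_int D * (Y m * Z (Suc m) - Y (Suc m) * Z m)"
      using recY[of m] recZ[of m]
      by (simp only: Suc_eq_plus1 add.assoc one_add_one) (simp add: algebra_simps)
    thus ?case using Suc vD by (simp add: padic_abs_mult)
  qed (simp add: \<omega>_def)
  have dist: "?v (\<zeta> m - \<zeta> (m + n)) = ?v (of_nat n) * ?v \<omega>" for m n
  proof -
    \<comment> \<open>The wedge with a fixed vector is linear, so it inherits the recurrence, and it
      vanishes at \<open>i = 0\<close>.\<close>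
    define s where "s i = Y m * Z (m + i) - Y (m + i) * Z m" for i
    have "?v (s n) = ?v (of_nat n) * ?v (s 1)"
    proof (rule padic_abs_recurrence)
      show "s (i + 2) = of_int T * s (i + 1) - of_int D * s i" for i
        using recY[of "m + i"] recZ[of "m + i"] unfolding s_def
        by (simp only: add.assoc) (simp add: algebra_simps)
    qed (use T D in \<open>auto simp: s_def P_def\<close>)
    moreover have "\<zeta> m - \<zeta> (m + n) = s n / (Z m * Z (m + n))"
      using nz by (simp add: s_def \<zeta>_def field_simps)
    ultimately show ?thesis
      using wedge_Suc[of m] unit by (simp add: s_def padic_abs_divide padic_abs_mult)
  qed
  have "?v (\<zeta> 0) \<le> 1" using Y0 Z0 by (simp add: \<zeta>_def padic_abs_divide)
  \<comment> \<open>\<open>K\<close> makes the approximation finer than \<open>\<omega>\<close>, so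
    that \<open>N\<close> lies in the ball containing the whole orbit.\<close>
  moreover obtain K where K: "1 / real ?p ^ K < ?v \<omega>"
  proof -
    have "?v \<omega> > 0" using \<omega> by (simp add: order_less_le)
    then obtain K where "(1 / real ?p) ^ K < ?v \<omega>"
      using p1 real_arch_pow_inv[of "?v \<omega>" "1 / real ?p"] by auto
    thus ?thesis using that by (simp add: power_divide)
  qed
  ultimately obtain N :: int where "?v (\<zeta> 0 - of_int N) \<le> 1 / real ?p ^ K"
    using padic_integer_approx by metis
  hence N: "?v (\<zeta> 0 - of_int N) \<le> ?v \<omega>" using K by simp
  have int: "?v ((\<zeta> m - of_int N) / \<omega>) \<le> 1" for m
  proof -
    have "?v (\<zeta> 0 - \<zeta> m) \<le> ?v \<omega>"
      using dist[of 0 m] padic_abs_of_int_le_1[of "int m", where 'p='p]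
      by (simp add: mult_left_le_one_le)
    from padic_abs_diff_le[OF N this] have "?v (\<zeta> m - of_int N) \<le> ?v \<omega>" by simp
    thus ?thesis using \<omega> by (simp add: padic_abs_divide divide_le_eq_1 order_less_le)
  qed
  have "\<exists>m. ?v (Y m - of_int N * Z m) \<le> 1 / real ?p ^ k" for k
  proof -
    have "\<exists>e::int. 0 \<le> e \<and> e < int ?p ^ k \<and> ?v ((\<zeta> m - of_int N) / \<omega> - of_int e) \<le> 1 / real ?p ^ k" for m
      using padic_integer_approx[OF int] by metis
    then obtain e :: "nat \<Rightarrow> int" where e: "\<And>m. 0 \<le> e m" "\<And>m. e m < int ?p ^ k"
      "\<And>m. ?v ((\<zeta> m - of_int N) / \<omega> - of_int (e m)) \<le> 1 / real ?p ^ k" by metis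
    have neq: "e m \<noteq> e n" if mn: "m < n" "n < ?p ^ k" for m n
    proof
      assume "e m = e n"
      hence "(\<zeta> m - \<zeta> n) / \<omega> =
          ((\<zeta> m - of_int N) / \<omega> - of_int (e m)) - ((\<zeta> n - of_int N) / \<omega> - of_int (e n))"
        by (simp add: diff_divide_distrib)
      hence "?v ((\<zeta> m - \<zeta> n) / \<omega>) \<le> 1 / real ?p ^ k"
        using padic_abs_diff_le[OF e(3) e(3)] by metis
      moreover have "?v ((\<zeta> m - \<zeta> n) / \<omega>) = ?v (of_int (int (n - m)))"
        using dist[of m "n - m"] mn \<omega> by (simp add: padic_abs_divide)
      ultimately have "int ?p ^ k dvd int (n - m)" using padic_abs_of_int_le_iff by metis
      hence "?p ^ k dvd n - m" by (metis int_dvd_int_iff of_nat_power)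
      thus False using mn by (auto dest!: dvd_imp_le)
    qed
    \<comment> \<open>Rescaled by \<open>\<omega>\<close>, the \<open>p ^ k\<close> ratios have
      distinct residues among only \<open>p ^ k\<close> possible ones, so the residue 0
      occurs.\<close>
    have "inj_on e {..<?p ^ k}"
      by (rule inj_onI) (metis neq lessThan_iff linorder_neqE_nat)
    moreover have "e ` {..<?p ^ k} \<subseteq> {0..<int ?p ^ k}" using e by auto
    moreover have "card {0..<int ?p ^ k} = card {..<?p ^ k}" by (simp add: nat_power_eq)
    ultimately have "e ` {..<?p ^ k} = {0..<int ?p ^ k}"
      by (intro card_subset_eq) (auto simp: card_image)
    moreover have "0 \<in> {0..<int ?p ^ k}" using p1 by simp
    ultimately obtain m where "e m = 0" by (metis imageE)
    hence "?v ((\<zeta> m - of_int N) / \<omega>) \<le> 1 / real ?p ^ k" using e(3)[of m] by simp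
    moreover have "Y m - of_int N * Z m = (\<zeta> m - of_int N) / \<omega> * \<omega> * Z m"
      using \<omega> nz[of m] by (simp add: \<zeta>_def field_simps)
    hence "?v (Y m - of_int N * Z m) = ?v ((\<zeta> m - of_int N) / \<omega>) * ?v \<omega>"
      using unit \<omega> by (simp add: padic_abs_mult padic_abs_divide)
    moreover have "?v \<omega> \<le> 1" unfolding \<omega>_def
      using unit by (intro padic_abs_diff_le) (simp_all add: padic_abs_mult mult_le_one)
    ultimately show ?thesis
      by (metis mult_left_le padic_abs_nonneg order_trans)
  qed
  thus ?thesis using that by blast
qed

section \<open>Words as products of continued fraction matrices\<close>

text \<open>The action of \<open>cf_matrix a\<close> on pairs, over an arbitrary ring so that one
  word acts on p-adic points and on integer vectors. Under \<open>fold\<close> the first letter acts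
  first.\<close>

definition cf_step :: "nat \<Rightarrow> 'a \<times> 'a \<Rightarrow> 'a \<times> 'a::comm_ring_1" where
  "cf_step a v = (snd v, fst v + of_nat a * snd v)"

lemma cf_step_sel [simp]:
  "fst (cf_step a v) = snd v" "snd (cf_step a v) = fst v + of_nat a * snd v"
  by (simp_all add: cf_step_def)

abbreviation word_power :: "'a list \<Rightarrow> nat \<Rightarrow> 'a list" where
  "word_power u m \<equiv> concat (replicate m u)"

lemma fold_word_power: "fold f (word_power u m) = (fold f u ^^ m)"
  by (induction m) (simp_all add: funpow_Suc_right del: funpow.simps(2))

text \<open>The images of the unit vectors over the integers are the columns of the matrix of
  \<open>u\<close>; integer matrices are represented this way below.\<close>

lemma fold_cf_step_linear:
  "fold cf_step u (y, z) =
    (of_int (fst (fold cf_step u (1, 0))) * y + of_int (fst (fold cf_step u (0, 1))) * z,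
     of_int (snd (fold cf_step u (1, 0))) * y + of_int (snd (fold cf_step u (0, 1))) * (z :: 'a :: comm_ring_1))"
  by (induction u rule: rev_induct) (auto simp: cf_step_def algebra_simps)

text \<open>Letter matrices have determinant -1, so the last letter can be undone modulo
  \<open>P\<close>.\<close>

lemma fold_cf_step_cong_cancel:
  fixes v v' :: "int \<times> int"
  assumes "[fst (fold cf_step u v) = fst (fold cf_step u v')] (mod P)"
    and "[snd (fold cf_step u v) = snd (fold cf_step u v')] (mod P)"
  shows "[fst v = fst v'] (mod P) \<and> [snd v = snd v'] (mod P)"
  using assms
proof (induction u rule: rev_induct)
  case (snoc a u)
  let ?x = "fold cf_step u v" and ?x' = "fold cf_step u v'"
  have s: "[snd ?x = snd ?x'] (mod P)"
    and f: "[fst ?x + int a * snd ?x = fst ?x' + int a * snd ?x'] (mod P)"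
    using snoc.prems by simp_all
  have "[int a * snd ?x = int a * snd ?x'] (mod P)" using s by (rule cong_scalar_left)
  from cong_diff[OF f this] have "[fst ?x = fst ?x'] (mod P)" by simp
  thus ?case using snoc.IH s by blast
qed simp

text \<open>Pigeonhole on the powers of \<open>u\<close> modulo \<open>P\<close>: two coincide, and
  cancelling the smaller one leaves the identity.\<close>

lemma cf_word_power_cong_identity:
  fixes P :: int
  assumes "P > 0"
  obtains M where "M \<ge> 1"
    "[fst (fold cf_step (word_power u M) (1, 0)) = 1] (mod P)"
    "[snd (fold cf_step (word_power u M) (1, 0)) = 0] (mod P)"
    "[fst (fold cf_step (word_power u M) (0, 1)) = 0] (mod P)"
    "[snd (fold cf_step (word_power u M) (0, 1)) = 1] (mod P)"
proof -
  define E where "E m v = fold cf_step (word_power u m) (v :: int \<times> int)" for m v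
  define S where "S m = ((fst (E m (1, 0)) mod P, snd (E m (1, 0)) mod P),
    (fst (E m (0, 1)) mod P, snd (E m (0, 1)) mod P))" for m
  have "range S \<subseteq> ({0..<P} \<times> {0..<P}) \<times> ({0..<P} \<times> {0..<P})"
    using assms by (auto simp: S_def)
  hence "finite (range S)" by (rule finite_subset) auto
  hence "\<not> inj S" using finite_imageD infinite_UNIV_nat by blast
  then obtain m n where mn: "m < n" "S m = S n"
    by (metis injI linorder_neqE_nat)
  have "E n v = fold cf_step (word_power u m) (E (n - m) v)" for v
  proof -
    have "word_power u n = word_power u (n - m) @ word_power u m"
      using mn(1) by (simp flip: concat_append replicate_add)
    thus ?thesis by (simp add: E_def)
  qed
  hence "[fst v = fst (E (n - m) v)] (mod P) \<and> [snd v = snd (E (n - m) v)] (mod P)"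
    if "v = (1, 0) \<or> v = (0, 1)" for v
    using mn(2) that
    by (intro fold_cf_step_cong_cancel[of "word_power u m"]) (auto simp: S_def E_def cong_def)
  from this[of "(1, 0)"] this[of "(0, 1)"] show ?thesis
    using mn(1) by (intro that[of "n - m"]) (auto simp: E_def cong_sym_eq)
qed

text \<open>A fixed point \<open>(y : z)\<close> is a zero of the form
  \<open>c Y^2 + (d - a) Y Z - b Z^2\<close>. Two such integer forms with a common irrational zero
  are proportional, and the minors expressing this are the entries of the commutator.\<close>

lemma fold_cf_step_commute:
  fixes y z :: "'a::idom" and x :: "int \<times> int"
  assumes irrational: "\<And>a b :: int. of_int a * y + of_int b * z = 0 \<Longrightarrow> a = 0 \<and> b = 0"
    and u: "y * snd (fold cf_step u (y, z)) = fst (fold cf_step u (y, z)) * z"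
    and v: "y * snd (fold cf_step v (y, z)) = fst (fold cf_step v (y, z)) * z"
  shows "fold cf_step (u @ v) x = fold cf_step (v @ u) x"
proof -
  obtain a c b d where u_entries: "fold cf_step u (1 :: int, 0) = (a, c)"
    "fold cf_step u (0, 1 :: int) = (b, d)"
    by fastforce
  obtain a' c' b' d' where v_entries: "fold cf_step v (1 :: int, 0) = (a', c')"
    "fold cf_step v (0, 1 :: int) = (b', d')"
    by fastforce
  have u1: "of_int c * y * y + of_int (d - a) * y * z - of_int b * z * z = 0"
    using u fold_cf_step_linear[of u y z] by (simp add: u_entries algebra_simps)
  have v1: "of_int c' * y * y + of_int (d' - a') * y * z - of_int b' * z * z = 0"
    using v fold_cf_step_linear[of v y z] by (simp add: v_entries algebra_simps)
  have "y \<noteq> 0" "z \<noteq> 0" using irrational[of 1 0] irrational[of 0 1] by auto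
  \<comment> \<open>This combination cancels the \<open>y * y\<close> terms and leaves
    \<open>z\<close> times an integral linear form, whose coefficients must vanish. The combination
    used for fact \<open>2\<close> cancels the \<open>z * z\<close> terms instead.\<close>
  have "z * (of_int ((d - a) * c' - (d' - a') * c) * y + of_int (b' * c - b * c') * z) =
      of_int c' * (of_int c * y * y + of_int (d - a) * y * z - of_int b * z * z) -
      of_int c * (of_int c' * y * y + of_int (d' - a') * y * z - of_int b' * z * z)"
    by (simp add: algebra_simps)
  hence 1: "(d - a) * c' - (d' - a') * c = 0 \<and> b' * c - b * c' = 0"
    unfolding u1 v1 using \<open>z \<noteq> 0\<close> by (intro irrational) simp
  have "y * (of_int (c * b' - c' * b) * y + of_int ((d - a) * b' - (d' - a') * b) * z) =
      of_int b' * (of_int c * y * y + of_int (d - a) * y * z - of_int b * z * z) -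
      of_int b * (of_int c' * y * y + of_int (d' - a') * y * z - of_int b' * z * z)"
    by (simp add: algebra_simps)
  hence 2: "c * b' - c' * b = 0 \<and> (d - a) * b' - (d' - a') * b = 0"
    unfolding u1 v1 using \<open>y \<noteq> 0\<close> by (intro irrational) simp
  obtain x1 x2 where x: "x = (x1, x2)" by fastforce
  have ux: "fold cf_step u (s, t) = (a * s + b * t, c * s + d * t)" for s t
    using fold_cf_step_linear[of u s t] by (simp add: u_entries)
  have vx: "fold cf_step v (s, t) = (a' * s + b' * t, c' * s + d' * t)" for s t
    using fold_cf_step_linear[of v s t] by (simp add: v_entries)
  have "a' * (a * x1 + b * x2) + b' * (c * x1 + d * x2) - (a * (a' * x1 + b' * x2) + b * (c' * x1 + d' * x2)) =
      (b' * c - b * c') * x1 + ((d - a) * b' - (d' - a') * b) * x2"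
    by (simp add: algebra_simps)
  moreover have "c' * (a * x1 + b * x2) + d' * (c * x1 + d * x2) - (c * (a' * x1 + b' * x2) + d * (c' * x1 + d' * x2)) =
      - ((d - a) * c' - (d' - a') * c) * x1 + (b * c' - b' * c) * x2"
    by (simp add: algebra_simps)
  ultimately show ?thesis using 1 2 by (simp add: x ux vx)
qed

text \<open>Staying in this cone guarantees a remainder strictly between 0 and the divisor when the
  last letter is recovered by division.\<close>

lemma fold_cf_step_pos:
  fixes v :: "int \<times> int"
  assumes "\<And>a. a \<in> set u \<Longrightarrow> a \<ge> 1" "0 < fst v" "fst v < snd v"
  shows "0 < fst (fold cf_step u v) \<and> fst (fold cf_step u v) < snd (fold cf_step u v)"
  using assms
proof (induction u rule: rev_induct)
  case (snoc a u)
  let ?x = "fold cf_step u v"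
  have IH: "0 < fst ?x" "fst ?x < snd ?x" using snoc by auto
  have "int a \<ge> 1" using snoc.prems(1)[of a] by simp
  hence "1 * snd ?x \<le> int a * snd ?x" using IH by (intro mult_right_mono) linarith+
  hence "snd ?x < fst ?x + int a * snd ?x" using IH by linarith
  thus ?case using IH by simp
qed auto

text \<open>Uniqueness of continued fractions: the last letter is the quotient, and the previous
  vector the remainder, of a division with remainder.\<close>

lemma fold_cf_step_inj:
  fixes v :: "int \<times> int"
  assumes "fold cf_step u v = fold cf_step u' v" "length u = length u'"
    and "\<And>a. a \<in> set u \<union> set u' \<Longrightarrow> a \<ge> 1" "0 < fst v" "fst v < snd v"
  shows "u = u'"
  using assms
proof (induction u arbitrary: u' rule: rev_induct)
  case (snoc a u)
  then obtain b t where t: "u' = t @ [b]" by (cases u' rule: rev_cases) auto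
  let ?x = "fold cf_step u v" and ?y = "fold cf_step t v"
  have x: "0 < fst ?x" "fst ?x < snd ?x" and y: "0 < fst ?y" "fst ?y < snd ?y"
    using fold_cf_step_pos[of u v] fold_cf_step_pos[of t v] snoc.prems t by auto
  have eq: "snd ?x = snd ?y" "fst ?x + int a * snd ?x = fst ?y + int b * snd ?x"
    using snoc.prems(1) by (auto simp: t prod_eq_iff)
  have "(fst ?x + int a * snd ?x) div snd ?x = int a" using x by simp
  moreover have "(fst ?y + int b * snd ?x) div snd ?x = int b" using y eq(1) by simp
  ultimately have ab: "a = b" using eq(2) by simp
  hence "?x = ?y" using eq by (simp add: prod_eq_iff)
  hence "u = t" using snoc.prems t by (intro snoc.IH) auto
  thus ?case using ab t by simp
qed simp

text \<open>Some power of \<open>u\<close> is congruent to the identity modulo p^2. If it moves the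
  point, the affine orbit approaches an integer \<open>N\<close>, which makes the form
  \<open>(1, -N)\<close> arbitrarily small; when the second coordinate is no unit, the coordinates
  change roles.\<close>

lemma padic_word_fixes_or_near_rational:
  fixes q :: "'p::prime_card padic \<times> 'p padic"
  assumes q: "max (padic_abs (fst q)) (padic_abs (snd q)) = 1"
  obtains (fixed) M where "M \<ge> 1"
      "fst q * snd (fold cf_step (word_power u M) q) = fst (fold cf_step (word_power u M) q) * snd q"
    | (near) a b :: int where "(a, b) \<noteq> (0, 0)"
      "\<And>k. \<exists>m. padic_abs (of_int a * fst (fold cf_step (word_power u m) q) +
        of_int b * snd (fold cf_step (word_power u m) q)) \<le> 1 / real CARD('p) ^ k"
proof -
  let ?P = "(int CARD('p))\<^sup>2"
  have "?P > 0" using prime_gt_0_nat[OF prime_card[where 'a='p]] by simp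
  then obtain M where M: "M \<ge> 1"
    "[fst (fold cf_step (word_power u M) (1, 0)) = 1] (mod ?P)"
    "[snd (fold cf_step (word_power u M) (1, 0)) = 0] (mod ?P)"
    "[fst (fold cf_step (word_power u M) (0, 1)) = 0] (mod ?P)"
    "[snd (fold cf_step (word_power u M) (0, 1)) = 1] (mod ?P)"
    by (rule cf_word_power_cong_identity)
  define X where "X m = fold cf_step (word_power u (M * m)) q" for m
  have X_Suc: "X (Suc m) = fold cf_step (word_power u M) (X m)" for m
    by (simp add: X_def fold_word_power funpow_add)
  have X0: "X 0 = q" and X1: "X 1 = fold cf_step (word_power u M) q" by (simp_all add: X_def)
  have lin: "fst (X (Suc m)) = of_int (fst (fold cf_step (word_power u M) (1, 0))) * fst (X m) +
      of_int (fst (fold cf_step (word_power u M) (0, 1))) * snd (X m)"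
    "snd (X (Suc m)) = of_int (snd (fold cf_step (word_power u M) (1, 0))) * fst (X m) +
      of_int (snd (fold cf_step (word_power u M) (0, 1))) * snd (X m)" for m
    unfolding X_Suc
    using fold_cf_step_linear[of "word_power u M" "fst (X m)" "snd (X m)"] by simp_all
  show ?thesis
  proof (cases "fst q * snd (X 1) = fst (X 1) * snd q")
    case True
    thus ?thesis using fixed[OF M(1)] unfolding X1 by blast
  next
    case False
    show ?thesis
    proof (cases "padic_abs (snd q) = 1")
      case True
      obtain N :: int where N: "\<And>k. \<exists>m. padic_abs (fst (X m) - of_int N * snd (X m)) \<le> 1 / real CARD('p) ^ k"
      proof (rule padic_orbit_near_rational[where Y = "\<lambda>m. fst (X m)"
        and Z = "\<lambda>m. snd (X m)", OF lin M(2,4,3,5)])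
        show "fst (X 0) * snd (X 1) - fst (X 1) * snd (X 0) \<noteq> 0" using False by (simp add: X0)
      qed (use True q in \<open>auto simp: X0 max_def split: if_splits\<close>)
      show ?thesis
      proof (rule near[of 1 "- N"])
        show "\<exists>m. padic_abs (of_int 1 * fst (fold cf_step (word_power u m) q) +
            of_int (- N) * snd (fold cf_step (word_power u m) q)) \<le> 1 / real CARD('p) ^ k" for k
          using N[of k] unfolding X_def by auto
      qed simp
    next
      case snd: False
      have lin': "snd (X (Suc m)) = of_int (snd (fold cf_step (word_power u M) (0, 1))) * snd (X m) +
          of_int (snd (fold cf_step (word_power u M) (1, 0))) * fst (X m)"
        "fst (X (Suc m)) = of_int (fst (fold cf_step (word_power u M) (0, 1))) * snd (X m) +
          of_int (fst (fold cf_step (word_power u M) (1, 0))) * fst (X m)" for m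
        using lin[of m] by (simp_all add: add.commute)
      obtain N :: int where N: "\<And>k. \<exists>m. padic_abs (snd (X m) - of_int N * fst (X m)) \<le> 1 / real CARD('p) ^ k"
      proof (rule padic_orbit_near_rational[where Y = "\<lambda>m. snd (X m)"
        and Z = "\<lambda>m. fst (X m)", OF lin' M(5,3,4,2)])
        show "snd (X 0) * fst (X 1) - snd (X 1) * fst (X 0) \<noteq> 0"
          using False by (simp add: X0 mult.commute)
      qed (use snd q in \<open>auto simp: X0 max_def split: if_splits\<close>)
      show ?thesis
      proof (rule near[of "- N" 1])
        show "\<exists>m. padic_abs (of_int (- N) * fst (fold cf_step (word_power u m) q) +
            of_int 1 * snd (fold cf_step (word_power u m) q)) \<le> 1 / real CARD('p) ^ k" for k
          using N[of k] unfolding X_def by auto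
      qed simp
    qed
  qed
qed

section \<open>Finite automata driven by a uniformly recurrent word\<close>

text \<open>Positions after some occurrence lie between consecutive occurrences at distance at most
  \<open>L\<close>; adding the position \<open>f\<close> of one occurrence handles the initial
  stretch.\<close>

lemma uniformly_recurrent_window:
  assumes "uniformly_recurrent w" "is_factor w u"
  obtains B where "\<And>i. \<exists>j\<in>occurrences w u. i \<le> j \<and> j \<le> i + B"
proof -
  let ?O = "occurrences w u"
  obtain L where inf: "infinite ?O"
    and L: "\<And>i j. i \<in> ?O \<Longrightarrow> j \<in> ?O \<Longrightarrow> i < j \<Longrightarrow> {i<..<j} \<inter> ?O = {} \<Longrightarrow> j - i \<le> L"
    using assms unfolding uniformly_recurrent_def by blast
  obtain f where f: "f \<in> ?O" using inf by (metis finite.emptyI ex_in_conv)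
  have "\<exists>j\<in>?O. i \<le> j \<and> j \<le> i + (L + f)" for i
  proof (cases "i \<le> f")
    case True
    thus ?thesis using f by (intro bexI[of _ f]) auto
  next
    case False
    define a where "a = Max {j \<in> ?O. j < i}"
    have "finite {j \<in> ?O. j < i}" by simp
    moreover have "{j \<in> ?O. j < i} \<noteq> {}" using f False by auto
    ultimately have a: "a \<in> ?O" "a < i" and amax: "\<And>j. j \<in> ?O \<Longrightarrow> j < i \<Longrightarrow> j \<le> a"
      unfolding a_def using Max_in by (blast, blast, simp)
    define b where "b = (LEAST j. j \<in> ?O \<and> i \<le> j)"
    have "\<exists>j. j \<in> ?O \<and> i \<le> j" using inf by (meson infinite_nat_iff_unbounded_le)
    hence b: "b \<in> ?O" "i \<le> b" unfolding b_def by (metis (mono_tags, lifting) LeastI_ex)+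
    have bmin: "b \<le> j" if "j \<in> ?O" "i \<le> j" for j
      unfolding b_def using that by (simp add: Least_le)
    have "{a<..<b} \<inter> ?O = {}" using amax bmin by (auto simp: not_le) (meson leD le_less_linear)
    hence "b - a \<le> L" using a b by (intro L) auto
    thus ?thesis using a b by (intro bexI[of _ b]) auto
  qed
  thus ?thesis using that by blast
qed

section \<open>Occurrences, factors and graph components\<close>

lemma subsequence_split:
  "i \<le> j \<Longrightarrow> j \<le> k \<Longrightarrow> subsequence w i k = subsequence w i j @ subsequence w j k"
  unfolding subsequence_def map_append[symmetric]
  using upt_add_eq_append[of i j "k - j"] by simp

lemma occurrences_iff: "i \<in> occurrences w u \<longleftrightarrow> subsequence w i (i + length u) = u"
  by (simp add: occurrences_def)

lemma occurrence_subsequence [simp]: "i \<le> j \<Longrightarrow> i \<in> occurrences w (subsequence w i j)"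
  by (simp add: occurrences_iff)

lemma occurrences_appendD:
  assumes "i \<in> occurrences w (u @ v)"
  shows "i \<in> occurrences w u" "i + length u \<in> occurrences w v"
proof -
  have "subsequence w i (i + length u) @ subsequence w (i + length u) (i + length u + length v) = u @ v"
    using assms subsequence_split[of i "i + length u" "i + length u + length v" w]
    by (simp add: occurrences_iff add.assoc)
  thus "i \<in> occurrences w u" "i + length u \<in> occurrences w v"
    by (simp_all add: occurrences_iff append_eq_append_conv)
qed

lemma finite_factors:
  assumes "finite (range w)"
  shows "finite (factors w n)"
proof (rule finite_subset)
  show "factors w n \<subseteq> {u. set u \<subseteq> range w \<and> length u = n}"
  proof
    fix u assume "u \<in> factors w n"
    then obtain i where "length u = n" "subsequence w i (i + length u) = u"
      unfolding factors_def is_factor_def occurrences_def by auto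
    moreover from this have "set u = w ` {i..<i + length u}" by (metis set_subsequence)
    ultimately show "u \<in> {u. set u \<subseteq> range w \<and> length u = n}" by auto
  qed
  show "finite {u. set u \<subseteq> range w \<and> length u = n}"
    using assms by (rule finite_lists_length_eq)
qed

text \<open>A function constant along edges descends to the components, and any representative
  recovers its value.\<close>

lemma card_image_le_card_connected_components:
  assumes fin: "finite V" and edge: "\<And>x y. (x, y) \<in> E \<Longrightarrow> f x = f y"
  shows "card (f ` V) \<le> card (connected_components V E)"
proof -
  define r where "r = {(x, y). x \<in> V \<and> y \<in> V \<and> (x, y) \<in> (E \<union> E\<inverse>)\<^sup>*}"
  have same: "f x = f y" if "(x, y) \<in> (E \<union> E\<inverse>)\<^sup>*" for x y
    using that by (induction rule: rtrancl_induct) (auto dest: edge)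
  have "f ` V \<subseteq> (\<lambda>X. f (SOME x. x \<in> X)) ` (V // r)"
  proof
    fix z assume "z \<in> f ` V"
    then obtain x where x: "x \<in> V" "z = f x" by blast
    hence "x \<in> r `` {x}" by (auto simp: r_def)
    hence "(SOME y. y \<in> r `` {x}) \<in> r `` {x}" by (rule someI)
    hence "z = f (SOME y. y \<in> r `` {x})" using same x(2) by (auto simp: r_def)
    moreover have "r `` {x} \<in> V // r" using x(1) by (rule quotientI)
    ultimately show "z \<in> (\<lambda>X. f (SOME x. x \<in> X)) ` (V // r)" by (rule image_eqI)
  qed
  moreover have "finite (V // r)" using fin by (simp add: quotient_def)
  ultimately have "card (f ` V) \<le> card (V // r)" by (rule surj_card_le[rotated])
  thus ?thesis by (simp add: connected_components_def r_def)
qed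

text \<open>The run of an automaton reading \<open>w\<close>; the states will be the points of the
  orbit modulo \<open>p ^ k\<close>. Injectivity keeps transported sets of states from
  shrinking.\<close>

locale word_automaton =
  fixes w :: "'a word" and c :: "nat \<Rightarrow> 's" and g :: "'a \<Rightarrow> 's \<Rightarrow> 's"
  assumes recurrent: "uniformly_recurrent w"
    and state_Suc: "\<And>n. c (Suc n) = g (w n) (c n)"
    and inj_transition: "\<And>a. inj (g a)"
    and finite_states: "finite (range c)"
begin

definition states_at :: "'a list \<Rightarrow> 's set" where
  "states_at u = c ` occurrences w u"

lemma finite_states_at [simp]: "finite (states_at u)"
  unfolding states_at_def by (rule finite_subset[OF _ finite_states]) auto

lemma inj_fold: "inj (fold g u)"
proof (induction u)
  case (Cons a u)
  show ?case using inj_compose[OF Cons inj_transition] by (simp add: comp_def)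
qed simp

lemma state_occurrence:
  assumes "i \<in> occurrences w u"
  shows "c (i + length u) = fold g u (c i)"
  using assms
proof (induction u arbitrary: i)
  case (Cons a u)
  have "subsequence w i (Suc i + length u) = subsequence w i (Suc i) @ subsequence w (Suc i) (Suc i + length u)"
    by (rule subsequence_split) auto
  hence "w i = a" "Suc i \<in> occurrences w u" using Cons.prems by (auto simp: occurrences_iff)
  thus ?case using Cons.IH[of "Suc i"] by (simp add: state_Suc)
qed auto

lemma fold_states_at_append: "fold g u ` states_at (u @ v) \<subseteq> states_at v"
proof
  fix x assume "x \<in> fold g u ` states_at (u @ v)"
  then obtain i where i: "i \<in> occurrences w (u @ v)" "x = fold g u (c i)"
    by (auto simp: states_at_def)
  hence "x = c (i + length u)" using occurrences_appendD(1) state_occurrence by metis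
  thus "x \<in> states_at v" using occurrences_appendD(2)[OF i(1)] by (simp add: states_at_def)
qed

lemma states_at_append_subset: "states_at (u @ v) \<subseteq> states_at u"
  unfolding states_at_def by (intro image_mono subsetI) (rule occurrences_appendD(1))

text \<open>Extending to the right leaves fewer occurrences; extending to the left transports the
  states injectively into those of \<open>v\<close>.\<close>

lemma card_states_at_append:
  "card (states_at (u @ v)) \<le> card (states_at u)" "card (states_at (u @ v)) \<le> card (states_at v)"
proof -
  show "card (states_at (u @ v)) \<le> card (states_at u)"
    by (intro card_mono states_at_append_subset) simp
  have "card (states_at (u @ v)) = card (fold g u ` states_at (u @ v))"
    by (rule card_image[symmetric]) (meson inj_fold inj_on_subset subset_UNIV)
  also have "\<dots> \<le> card (states_at v)" by (intro card_mono fold_states_at_append) simp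
  finally show "card (states_at (u @ v)) \<le> card (states_at v)" .
qed

text \<open>A factor with fewest states occurs in every sufficiently long factor, and the number of
  states can only drop when a factor is extended.\<close>

lemma card_states_at_eventually_constant:
  obtains L \<mu> where "\<And>i k. k \<ge> L \<Longrightarrow> card (states_at (subsequence w i (i + k))) = \<mu>"
proof -
  have "is_factor w []" by (auto simp: is_factor_def occurrences_def)
  then obtain u where u: "is_factor w u"
    and min: "\<And>v. is_factor w v \<Longrightarrow> card (states_at u) \<le> card (states_at v)"
    using ex_has_least_nat[of "is_factor w" "[]" "\<lambda>v. card (states_at v)"] by blast
  define \<mu> where "\<mu> = card (states_at u)"
  obtain B where B: "\<And>i. \<exists>j\<in>occurrences w u. i \<le> j \<and> j \<le> i + B"
    using uniformly_recurrent_window[OF recurrent u] by blast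
  have "card (states_at (subsequence w i (i + k))) = \<mu>" if k: "k \<ge> B + length u" for i k
  proof (rule antisym)
    obtain j where j: "j \<in> occurrences w u" "i \<le> j" "j \<le> i + B" using B by blast
    have "subsequence w i (i + k) = subsequence w i j @ subsequence w j (j + length u) @ subsequence w (j + length u) (i + k)"
      using j k subsequence_split[of i j "i + k" w] subsequence_split[of j "j + length u" "i + k" w]
      by simp
    also have "subsequence w j (j + length u) = u" using j(1) by (simp add: occurrences_iff)
    finally show "card (states_at (subsequence w i (i + k))) \<le> \<mu>"
      unfolding \<mu>_def by (metis card_states_at_append order_trans)
    show "\<mu> \<le> card (states_at (subsequence w i (i + k)))"
      unfolding \<mu>_def
      by (rule min) (auto simp: is_factor_def intro!: exI[of _ i] simp flip: ex_in_conv)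
  qed
  thus ?thesis using that by blast
qed

text \<open>The sets for ever longer factors starting at \<open>i\<close> are nested and of equal
  finite size, hence equal. The same count turns the inclusion under transport along
  \<open>w\<close> into an equality.\<close>

lemma limit_states:
  obtains R L where
    "\<And>i k. k \<ge> L \<Longrightarrow> states_at (subsequence w i (i + k)) = R i"
    "\<And>i j. i \<le> j \<Longrightarrow> fold g (subsequence w i j) ` R i = R j"
proof -
  obtain L \<mu> where L: "\<And>i k. k \<ge> L \<Longrightarrow> card (states_at (subsequence w i (i + k))) = \<mu>"
    by (rule card_states_at_eventually_constant) blast
  define R where "R i = states_at (subsequence w i (i + L))" for i
  have R: "states_at (subsequence w i (i + k)) = R i" if "k \<ge> L" for i k
    unfolding R_def
  proof (rule card_subset_eq)
    have "subsequence w i (i + k) = subsequence w i (i + L) @ subsequence w (i + L) (i + k)"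
      using that by (intro subsequence_split) auto
    thus "states_at (subsequence w i (i + k)) \<subseteq> states_at (subsequence w i (i + L))"
      using states_at_append_subset by metis
  qed (use L that in auto)
  have fold_R: "fold g (subsequence w i j) ` R i = R j" if "i \<le> j" for i j
  proof (rule card_subset_eq)
    have "subsequence w i (i + (j - i + L)) = subsequence w i j @ subsequence w j (j + L)"
      using that subsequence_split[of i j "j + L" w] by simp
    moreover have "R i = states_at (subsequence w i (i + (j - i + L)))" by (rule R[symmetric]) simp
    ultimately show "fold g (subsequence w i j) ` R i \<subseteq> R j"
      using fold_states_at_append by (simp add: R_def)
    have "card (fold g (subsequence w i j) ` R i) = card (R i)"
      by (rule card_image) (meson inj_fold inj_on_subset subset_UNIV)
    thus "card (fold g (subsequence w i j) ` R i) = card (R j)" by (simp add: R_def L)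
  qed (simp add: R_def)
  show ?thesis by (rule that[of L R]) (erule R, erule fold_R)
qed

text \<open>For an edge from \<open>s\<close> to \<open>t\<close>, the states pushed through
  \<open>s\<close> and the states at the start of \<open>t\<close> are both the limit set at the
  boundary position. So \<open>f\<close> is constant on components, and its values on right vertices
  include every \<open>R i\<close>.\<close>

lemma card_range_limit_states:
  assumes fin: "finite (range w)"
    and R: "\<And>i k. k \<ge> L \<Longrightarrow> states_at (subsequence w i (i + k)) = R i"
    and fold_R: "\<And>i j. i \<le> j \<Longrightarrow> fold g (subsequence w i j) ` R i = R j"
    and C: "\<And>n. n \<ge> 1 \<Longrightarrow>
      card (connected_components (factor_graph_verts w n) (factor_graph_edges w n)) \<le> C"
  shows "finite (range R)" "card (range R) \<le> C"
proof -
  \<comment> \<open>The length must reach \<open>L\<close>, and the bound on components is given for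
    positive lengths.\<close>
  define n where "n = max 1 L"
  define f where "f = case_sum (\<lambda>s. fold g s ` states_at s) states_at"
  have finV: "finite (factor_graph_verts w n)"
    unfolding factor_graph_verts_def using finite_factors[OF fin] by (intro finite_Plus)
  have edge: "f x = f y" if xy: "(x, y) \<in> factor_graph_edges w n" for x y
  proof -
    obtain s t i where st: "x = Inl s" "y = Inr t" "length s = n" "length t = n"
      "i \<in> occurrences w (s @ t)"
      using xy by (auto simp: factor_graph_edges_def factors_def is_factor_def)
    have s: "s = subsequence w i (i + n)" using occurrences_appendD(1)[OF st(5)] st
      by (simp add: occurrences_iff)
    have t: "t = subsequence w (i + n) (i + n + n)" using occurrences_appendD(2)[OF st(5)] st
      by (simp add: occurrences_iff)
    have "states_at s = R i" "states_at t = R (i + n)" unfolding s t by (rule R, simp add: n_def)+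
    thus ?thesis using fold_R[of i "i + n"] by (simp add: f_def st s)
  qed
  have sub: "range R \<subseteq> f ` factor_graph_verts w n"
  proof
    fix Z assume "Z \<in> range R"
    then obtain i where "Z = R i" by blast
    hence "Z = f (Inr (subsequence w i (i + n)))" using R[of n i] by (simp add: f_def n_def)
    moreover have "Inr (subsequence w i (i + n)) \<in> factor_graph_verts w n"
      by (auto simp: factor_graph_verts_def factors_def is_factor_def simp flip: ex_in_conv intro!: exI[of _ i])
    ultimately show "Z \<in> f ` factor_graph_verts w n" by blast
  qed
  show "finite (range R)" using sub finV by (meson finite_imageI finite_subset)
  have "card (range R) \<le> card (f ` factor_graph_verts w n)"
    using sub finV by (intro card_mono) auto
  also have "\<dots> \<le> card (connected_components (factor_graph_verts w n) (factor_graph_edges w n))"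
    by (rule card_image_le_card_connected_components[OF finV edge])
  also have "\<dots> \<le> C" by (rule C) (simp add: n_def)
  finally show "card (range R) \<le> C" .
qed

end

section \<open>Points of LMad and their lattices\<close>

text \<open>The letter matrix is invertible over the p-adic integers, so it preserves the maximum
  norm.\<close>

lemma cf_step_max_padic_abs:
  fixes q :: "'p::prime_card padic \<times> 'p padic"
  assumes "max (padic_abs (fst q)) (padic_abs (snd q)) = 1"
  shows "max (padic_abs (fst (cf_step a q))) (padic_abs (snd (cf_step a q))) = 1"
proof -
  have le: "padic_abs (of_nat a * snd q) \<le> padic_abs (snd q)"
    using padic_abs_of_int_le_1[of "int a", where 'p='p]
    by (simp add: padic_abs_mult mult_left_le_one_le)
  show ?thesis
  proof (cases "padic_abs (snd q) = 1")
    case True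
    moreover have "padic_abs (fst q) \<le> 1" using assms by (simp add: max_def split: if_splits)
    ultimately have "padic_abs (fst q + of_nat a * snd q) \<le> 1" using le
      by (intro padic_abs_add_le) auto
    thus ?thesis using True by simp
  next
    case False
    hence "padic_abs (snd q) < 1" "padic_abs (fst q) = 1" using assms
      by (auto simp: max_def split: if_splits)
    thus ?thesis using le padic_abs_add_eq[of "of_nat a * snd q" "fst q"]
      by (simp add: add.commute max_def)
  qed
qed

text \<open>Dividing by a coordinate of largest absolute value gives norm 1, which persists along
  the orbit and removes the denominator from \<open>is_PBad\<close>.\<close>

lemma LMad_eps_vectors:
  fixes x :: "'p::prime_card padic_proj_line"
  assumes "(w, x) \<in> LMad_eps \<epsilon>"
  obtains q :: "nat \<Rightarrow> 'p padic \<times> 'p padic" where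
    "\<And>n. q (Suc n) = cf_step (w n) (q n)"
    "\<And>n. max (padic_abs (fst (q n))) (padic_abs (snd (q n))) = 1"
    "\<And>n a b. (a, b) \<noteq> (0, 0) \<Longrightarrow> \<epsilon> / real_of_int (max (a\<^sup>2) (b\<^sup>2)) \<le>
      padic_abs (of_int a * fst (q n) + of_int b * snd (q n))"
proof -
  define v where "v = rep_padic_proj_line x"
  have rv: "proj_rel v v" unfolding v_def by (rule Quotient_rep_reflp[OF Quotient_padic_proj_line])
  have xv: "x = abs_padic_proj_line v"
    unfolding v_def by (rule Quotient_abs_rep[OF Quotient_padic_proj_line, symmetric])
  define s where "s = (if padic_abs (v $ 1) \<ge> padic_abs (v $ 2) then v $ 1 else v $ 2)"
  have s_max: "padic_abs s = max (padic_abs (v $ 1)) (padic_abs (v $ 2))" by (simp add: s_def)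
  have "v \<noteq> 0" using rv by (simp add: proj_rel_def)
  hence "padic_abs (v $ 1) > 0 \<or> padic_abs (v $ 2) > 0"
    by (auto simp: vec_eq_iff forall_2 order_less_le)
  hence s_pos: "padic_abs s > 0" using s_max by (auto simp: less_max_iff_disj)
  hence s0: "s \<noteq> 0" by auto
  define q where "q = rec_nat (v $ 1 / s, v $ 2 / s) (\<lambda>n. cf_step (w n))"
  have q_Suc: "q (Suc n) = cf_step (w n) (q n)" for n by (simp add: q_def)
  have q_max: "max (padic_abs (fst (q n))) (padic_abs (snd (q n))) = 1" for n
  proof (induction n)
    case 0
    have "max (padic_abs (v $ 1) / padic_abs s) (padic_abs (v $ 2) / padic_abs s) = padic_abs s / padic_abs s"
      using s_pos s_max by (auto simp: max_def divide_le_cancel split: if_splits)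
    thus ?case using s0 by (simp add: q_def padic_abs_divide)
  qed (simp add: q_Suc cf_step_max_padic_abs del: cf_step_sel)
  define V where "V n = (vector [fst (q n), snd (q n)] :: 'p padic ^ 2)" for n
  have V: "V n $ 1 = fst (q n)" "V n $ 2 = snd (q n)" for n by (simp_all add: V_def)
  have rV: "proj_rel (V n) (V n)" for n
  proof -
    have "V n \<noteq> 0" using q_max[of n] V[of n] by (auto simp: vec_eq_iff forall_2)
    thus ?thesis by (auto simp: proj_rel_def intro: exI[of _ 1])
  qed
  have iter: "(word_proj_shift ^^ n) (w, x) = (suffix n w, abs_padic_proj_line (V n))" for n
  proof (induction n)
    case 0
    have "V 0 = inverse s *s v" by (simp add: vec_eq_iff forall_2 V q_def field_simps)
    hence "proj_rel v (V 0)" using rv rV[of 0] s0 unfolding proj_rel_def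
      by (intro conjI exI[of _ "inverse s"]) auto
    hence "abs_padic_proj_line v = abs_padic_proj_line (V 0)"
      by (rule Quotient_rel_abs[OF Quotient_padic_proj_line])
    thus ?case by (simp add: xv)
  next
    case (Suc n)
    have "cf_matrix (w n) *v V n = V (Suc n)"
      by (simp add: cf_matrix_mult vec_eq_iff forall_2 V q_Suc)
    hence "cf_act (w n) (abs_padic_proj_line (V n)) = abs_padic_proj_line (V (Suc n))"
      using cf_act.abs_eq[OF rV[of n]] by simp
    hence "word_proj_shift (suffix n w, abs_padic_proj_line (V n)) =
        (suffix (Suc n) w, abs_padic_proj_line (V (Suc n)))"
      by (simp add: word_proj_shift_def del: suffix_nth) simp
    thus ?case by (simp only: funpow.simps o_apply Suc.IH)
  qed
  have "\<epsilon> / real_of_int (max (a\<^sup>2) (b\<^sup>2)) \<le> padic_abs (of_int a * fst (q n) + of_int b * snd (q n))"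
    if "(a, b) \<noteq> (0, 0)" for n a b
  proof -
    have "is_PBad \<epsilon> (abs_padic_proj_line (V n))"
      using assms iter[of n] unfolding LMad_eps_def PBad_def
      by (metis (mono_tags, lifting) mem_Collect_eq mem_Sigma_iff)
    thus ?thesis using that q_max[of n] unfolding is_PBad.abs_eq[OF rV] by (simp add: V)
  qed
  thus ?thesis using that q_Suc q_max by blast
qed

text \<open>This lattice encodes the point \<open>q\<close> modulo \<open>p\<^sup>k\<close>. Being badly approximable means that
  its shortest nonzero vector has size at least a constant times \<open>p\<close> to the power \<open>k / 2\<close>.\<close>

definition padic_lattice :: "nat \<Rightarrow> 'p::prime_card padic \<times> 'p padic \<Rightarrow> (int \<times> int) set" where
  "padic_lattice k q = {(a, b). padic_abs (of_int a * fst q + of_int b * snd q) \<le> 1 / real CARD('p) ^ k}"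

text \<open>The preimage of \<open>S\<close> under the symmetric letter matrix: pairing
  \<open>(a, b)\<close> with the transformed vector is pairing its image with the original
  one.\<close>

definition lattice_step :: "nat \<Rightarrow> (int \<times> int) set \<Rightarrow> (int \<times> int) set" where
  "lattice_step c S = {(a, b). (b, a + int c * b) \<in> S}"

lemma inj_lattice_step: "inj (lattice_step c)"
proof (rule inj_on_inverseI)
  show "{(a, b). (b - int c * a, a) \<in> lattice_step c S} = S" for S
    by (auto simp: lattice_step_def)
qed

lemma padic_lattice_cf_step: "padic_lattice k (cf_step c q) = lattice_step c (padic_lattice k q)"
  by (auto simp: padic_lattice_def lattice_step_def algebra_simps)

lemma padic_lattice_fold: "padic_lattice k (fold cf_step u q) = fold lattice_step u (padic_lattice k q)"
  by (induction u arbitrary: q) (simp_all add: padic_lattice_cf_step)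

text \<open>Level \<open>k + 1\<close> determines level \<open>k\<close>, which makes the equality
  of state sets at successive levels a refining relation.\<close>

lemma padic_lattice_Suc:
  "padic_lattice k q =
    {(a, b). (int CARD('p) * a, int CARD('p) * b) \<in> padic_lattice (Suc k) (q :: 'p::prime_card padic \<times> 'p padic)}"
proof -
  have "of_int (int CARD('p) * a) * fst q + of_int (int CARD('p) * b) * snd q =
      of_nat CARD('p) * (of_int a * fst q + of_int b * snd q)" for a b
    by (simp add: algebra_simps)
  thus ?thesis using real_card_gt_1[where 'p='p]
    by (auto simp: padic_lattice_def padic_abs_mult padic_abs_card divide_simps)
qed

text \<open>Since the coordinates are integral, membership depends on \<open>a\<close> and
  \<open>b\<close> modulo \<open>p ^ k\<close> only, so a finite box determines the lattice.\<close>

lemma finite_padic_lattices: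
  fixes q :: "'i \<Rightarrow> 'p::prime_card padic \<times> 'p padic"
  assumes "\<And>n. max (padic_abs (fst (q n))) (padic_abs (snd (q n))) = 1"
  shows "finite (range (\<lambda>n. padic_lattice k (q n)))"
proof -
  let ?P = "int CARD('p) ^ k"
  let ?box = "{0..<?P} \<times> {0..<?P}"
  have P: "?P > 0" using prime_gt_0_nat[OF prime_card[where 'a='p]] by simp
  have mod: "(a mod ?P, b mod ?P) \<in> padic_lattice k (q n) \<longleftrightarrow> (a, b) \<in> padic_lattice k (q n)" for a b n
  proof -
    define e where "e = of_int (?P * (a div ?P)) * fst (q n) + of_int (?P * (b div ?P)) * snd (q n)"
    define f where "f = of_int (a mod ?P) * fst (q n) + of_int (b mod ?P) * snd (q n)"
    have small: "padic_abs (of_int (?P * c) * y) \<le> 1 / real CARD('p) ^ k"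
      if "padic_abs y \<le> 1" for c and y :: "'p padic"
      using mult_mono[of "padic_abs (of_int (?P * c) :: 'p padic)" "1 / real CARD('p) ^ k"
      "padic_abs y" 1]
        that padic_abs_of_int_le_iff[of "?P * c" k, where 'p='p]
      by (simp add: padic_abs_mult del: of_int_mult)
    have "padic_abs e \<le> 1 / real CARD('p) ^ k"
      unfolding e_def using assms[of n]
      by (intro padic_abs_add_le small) (auto simp: max_def split: if_splits)
    hence "padic_abs (e + f) \<le> 1 / real CARD('p) ^ k \<longleftrightarrow> padic_abs f \<le> 1 / real CARD('p) ^ k"
      using padic_abs_add_le[of e _ f] padic_abs_diff_le[of "e + f" _ e] by auto
    moreover have "e + f = of_int a * fst (q n) + of_int b * snd (q n)"
    proof -
      have "e + f = of_int (?P * (a div ?P) + a mod ?P) * fst (q n) + of_int (?P * (b div ?P) + b mod ?P) * snd (q n)"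
        unfolding e_def f_def of_int_add by (simp only: algebra_simps)
      thus ?thesis by simp
    qed
    ultimately show ?thesis by (simp add: padic_lattice_def f_def)
  qed
  have "inj_on (\<lambda>S. S \<inter> ?box) (range (\<lambda>n. padic_lattice k (q n)))"
  proof (rule inj_onI, clarify)
    fix m n assume "padic_lattice k (q m) \<inter> ?box = padic_lattice k (q n) \<inter> ?box"
    moreover have "(a mod ?P, b mod ?P) \<in> ?box" for a b using P by simp
    ultimately have "(a, b) \<in> padic_lattice k (q m) \<longleftrightarrow> (a, b) \<in> padic_lattice k (q n)" for a b
      using mod[of a b m] mod[of a b n] by (metis IntD1 IntI)
    thus "padic_lattice k (q m) = padic_lattice k (q n)" by auto
  qed
  moreover have "finite ((\<lambda>S. S \<inter> ?box) ` range (\<lambda>n. padic_lattice k (q n)))"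
    by (rule finite_subset[of _ "Pow ?box"]) auto
  ultimately show ?thesis by (rule finite_imageD[rotated])
qed

section \<open>Non-periodic words\<close>

text \<open>Given \<open>C + 1\<close> indices with distinct sequences, each pair is separated at
  some level; by refinement the largest of these levels separates all of them at once, exceeding the
  bound there.\<close>

lemma finite_range_refining:
  fixes r :: "nat \<Rightarrow> 'i \<Rightarrow> 'b"
  assumes refine: "\<And>k i j. r (Suc k) i = r (Suc k) j \<Longrightarrow> r k i = r k j"
    and fin: "\<And>k. finite (range (r k))" and card: "\<And>k. card (range (r k)) \<le> C"
  shows "finite (range (\<lambda>i k. r k i))"
proof (rule ccontr)
  assume "infinite (range (\<lambda>i k. r k i))"
  then obtain F where F: "F \<subseteq> range (\<lambda>i k. r k i)" "finite F" "card F = Suc C"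
    using infinite_arbitrarily_large by metis
  then obtain A where A: "inj_on (\<lambda>i k. r k i) A" "F = (\<lambda>i k. r k i) ` A"
    using subset_image_inj[of F "\<lambda>i k. r k i" UNIV] by auto
  have finA: "finite A" and cardA: "card A = Suc C" using A F
    by (auto simp: card_image finite_image_iff)
  have mono: "r k i = r k j" if "r l i = r l j" "k \<le> l" for k l i j
    using that(2,1) by (induction l rule: dec_induct) (auto dest: refine)
  have "\<exists>k. i \<noteq> j \<longrightarrow> r k i \<noteq> r k j" if "i \<in> A" "j \<in> A" for i j
    using inj_onD[OF A(1) _ that] by auto
  then obtain sep where sep: "\<And>i j. i \<in> A \<Longrightarrow> j \<in> A \<Longrightarrow> i \<noteq> j \<Longrightarrow> r (sep i j) i \<noteq> r (sep i j) j"
    by metis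
  define K where "K = Max (case_prod sep ` (A \<times> A))"
  have "sep i j \<le> K" if "i \<in> A" "j \<in> A" for i j
    unfolding K_def using finA that by (intro Max_ge) auto
  hence "inj_on (r K) A" using sep mono by (meson inj_onI)
  hence "Suc C \<le> card (range (r K))"
    using card_mono[OF fin, of "r K ` A" K] cardA by (simp add: card_image image_mono)
  thus False using card[of K] by simp
qed

text \<open>The prefix up to position \<open>n + k\<close> occurs again beyond \<open>i\<close>,
  where the equality is known.\<close>

lemma periodic_if_suffix_periodic:
  assumes rec: "uniformly_recurrent w" and k: "k > 0"
    and per: "\<And>n. n \<ge> i \<Longrightarrow> w (n + k) = w n"
  shows "periodic_word w"
  unfolding periodic_word_def
proof (intro exI conjI ext)
  fix n
  let ?u = "subsequence w 0 (n + k + 1)"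
  have "0 \<in> occurrences w ?u" by (rule occurrence_subsequence) simp
  hence "infinite (occurrences w ?u)"
    using rec unfolding uniformly_recurrent_def is_factor_def by blast
  then obtain m where m: "m \<ge> i" "m \<in> occurrences w ?u"
    by (meson infinite_nat_iff_unbounded_le)
  hence eq: "subsequence w m (m + (n + k + 1)) = ?u" by (simp add: occurrences_iff)
  have "w (m + l) = w l" if "l < n + k + 1" for l
    using arg_cong[OF eq, of "\<lambda>xs. xs ! l"] that
      subsequence_nth[of l "m + (n + k + 1)" m w] subsequence_nth[of l "n + k + 1" 0 w]
    by (metis add_0 add_diff_cancel_left' diff_zero)
  from this[of n] this[of "n + k"] show "suffix k w n = w n"
    using per[of "m + n"] m by (simp add: add.commute add.left_commute)
qed (use k in simp)

lemma length_word_power: "length (word_power u m) = m * length u"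
  by (induction m) auto

text \<open>At index \<open>length v + (n - i)\<close> one side of the commutation reads
  \<open>w (n + length v)\<close>, the other \<open>w n\<close>.\<close>

lemma periodic_if_prefix_powers_commute:
  assumes long: "\<And>n. \<exists>j M. j \<ge> i + n \<and> M \<ge> 1 \<and>
      v @ word_power (subsequence w i j) M = word_power (subsequence w i j) M @ v"
    and n: "n \<ge> i"
  shows "w (n + length v) = w n"
proof -
  \<comment> \<open>\<open>j\<close> is so large that a single copy of the prefix covers both
    positions.\<close>
  obtain j M where jM: "j \<ge> i + (n + length v + 1)" "M \<ge> 1"
    and eq: "v @ word_power (subsequence w i j) M = word_power (subsequence w i j) M @ v"
    using long by blast
  obtain M' where M': "M = Suc M'" using jM(2) by (cases M) auto
  have pw: "(word_power (subsequence w i j) M @ zs) ! l = w (i + l)" if "l < j - i" for l zs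
    using that by (simp add: M' nth_append)
  have "w (n + length v) = (word_power (subsequence w i j) M @ v) ! (length v + (n - i))"
    using jM n by (subst pw) (auto simp: ac_simps)
  also have "\<dots> = (word_power (subsequence w i j) M @ []) ! (n - i)" by (simp flip: eq)
  also have "\<dots> = w n" using jM n by (subst pw) auto
  finally show ?thesis .
qed

theorem theorem4:
  fixes N :: nat and w :: "nat word"
  assumes "w \<in> words_upto N"
    and "\<not> periodic_word w"
    and "uniformly_recurrent w"
    and "\<exists>C::nat. \<forall>n\<ge>1.
      card (connected_components (factor_graph_verts w n) (factor_graph_edges w n)) \<le> C"
  shows "\<forall>x :: 'p::prime_card padic_proj_line. (w, x) \<notin> LMad"
proof (intro allI notI)
  fix x :: "'p padic_proj_line"
  assume "(w, x) \<in> LMad"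
  then obtain \<epsilon> where eps: "\<epsilon> > 0" "(w, x) \<in> LMad_eps \<epsilon>" by (auto simp: LMad_def)
  obtain C where C: "\<And>n. n \<ge> 1 \<Longrightarrow>
      card (connected_components (factor_graph_verts w n) (factor_graph_edges w n)) \<le> C"
    using assms(4) by blast
  have fin_w: "finite (range w)" and pos_w: "\<And>i. w i \<ge> 1"
    using assms(1) by (auto simp: words_upto_def intro!: finite_subset[of "range w" "{1..N}"])
  obtain q :: "nat \<Rightarrow> 'p padic \<times> 'p padic" where
    q_Suc: "\<And>n. q (Suc n) = cf_step (w n) (q n)" and
    q_max: "\<And>n. max (padic_abs (fst (q n))) (padic_abs (snd (q n))) = 1" and
    bad: "\<And>n a b. (a, b) \<noteq> (0, 0) \<Longrightarrow> \<epsilon> / real_of_int (max (a\<^sup>2) (b\<^sup>2)) \<le>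
      padic_abs (of_int a * fst (q n) + of_int b * snd (q n))"
    using LMad_eps_vectors[OF eps(2)] by blast
  have bad_pos: "\<epsilon> / real_of_int (max (a\<^sup>2) (b\<^sup>2)) > 0" if "(a, b) \<noteq> (0, 0)" for a b
    using that eps(1) by (auto simp: less_max_iff_disj)

  have automaton: "word_automaton w (\<lambda>n. padic_lattice k (q n)) lattice_step" for k
    by unfold_locales (auto simp: assms(3) q_Suc padic_lattice_cf_step inj_lattice_step
        intro: finite_padic_lattices q_max)
  have "\<exists>R L. (\<forall>i n. n \<ge> L \<longrightarrow> (\<lambda>n. padic_lattice k (q n)) ` occurrences w (subsequence w i (i + n)) = R i) \<and>
      (\<forall>i j. i \<le> j \<longrightarrow> fold lattice_step (subsequence w i j) ` R i = R j) \<and>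
      finite (range R) \<and> card (range R) \<le> C" for k
  proof -
    interpret word_automaton w "\<lambda>n. padic_lattice k (q n)" lattice_step by (rule automaton)
    show ?thesis
    proof (rule limit_states)
      fix R L
      assume RL: "\<And>i n. n \<ge> L \<Longrightarrow> states_at (subsequence w i (i + n)) = R i"
        "\<And>i j. i \<le> j \<Longrightarrow> fold lattice_step (subsequence w i j) ` R i = R j"
      have "finite (range R)" "card (range R) \<le> C"
        by (rule card_range_limit_states[where L = L and R = R, OF fin_w]; erule RL C)+
      thus ?thesis using RL unfolding states_at_def
        by (intro exI[of _ R] exI[of _ L] conjI allI impI) simp_all
    qed
  qed
  then obtain R L where
    R: "\<And>k i n. n \<ge> L k \<Longrightarrow>
      (\<lambda>n. padic_lattice k (q n)) ` occurrences w (subsequence w i (i + n)) = R k i" and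
    R_fold: "\<And>k i j. i \<le> j \<Longrightarrow> fold lattice_step (subsequence w i j) ` R k i = R k j" and
    R_fin: "\<And>k. finite (range (R k))" and R_card: "\<And>k. card (range (R k)) \<le> C"
    by metis
  have q_in_R: "padic_lattice k (q i) \<in> R k i" for k i
    by (subst R[of k "L k", symmetric]) auto
  have R_range: "R k i \<subseteq> range (\<lambda>n. padic_lattice k (q n))" for k i
    by (subst R[of k "L k", symmetric]) auto
  have R_refine: "R k i = R k j" if "R (Suc k) i = R (Suc k) j" for k i j
  proof -
    define down where "down = (\<lambda>S. {(a, b). (int CARD('p) * a, int CARD('p) * b) \<in> (S :: (int \<times> int) set)})"
    have "R k i = down ` R (Suc k) i" for i
    proof -
      define n where "n = max (L k) (L (Suc k))"
      have "R k i = (\<lambda>n. padic_lattice k (q n)) ` occurrences w (subsequence w i (i + n))"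
        by (rule R[symmetric]) (simp add: n_def)
      also have "\<dots> = down ` (\<lambda>n. padic_lattice (Suc k) (q n)) ` occurrences w (subsequence w i (i + n))"
        unfolding image_image down_def by (subst padic_lattice_Suc) (rule refl)
      also have "(\<lambda>n. padic_lattice (Suc k) (q n)) ` occurrences w (subsequence w i (i + n)) = R (Suc k) i"
        by (rule R) (simp add: n_def)
      finally show ?thesis .
    qed
    thus ?thesis using that by metis
  qed

  have "finite (range (\<lambda>i k. R k i))"
    by (rule finite_range_refining[where r = R, OF R_refine R_fin R_card])
  \<comment> \<open>Only finitely many sequences occur, so some position shares its sets at all
    levels \<open>k\<close> with infinitely many others.\<close>
  then obtain i where "infinite {j. (\<lambda>k. R k j) = (\<lambda>k. R k i)}"
    using pigeonhole_infinite[of "UNIV :: nat set" "\<lambda>i k. R k i"] by auto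
  hence unbounded: "\<exists>j\<ge>n. \<forall>k. R k j = R k i" for n
    unfolding infinite_nat_iff_unbounded_le by (auto dest!: spec[of _ n] dest: fun_cong)

  have power_fixes: "\<exists>M\<ge>1. fst (q i) * snd (fold cf_step (word_power (subsequence w i j) M) (q i)) =
      fst (fold cf_step (word_power (subsequence w i j) M) (q i)) * snd (q i)"
    if "i \<le> j" and same: "\<And>k. R k j = R k i" for j
  proof -
    define u where "u = subsequence w i j"
    \<comment> \<open>Since \<open>u\<close> maps \<open>R k i\<close> onto itself, each iterate
      agrees modulo \<open>p ^ k\<close> with some actual orbit point \<open>q n\<close>, whose
      approximation bound it inherits at that level.\<close>
    have in_R: "padic_lattice k (fold cf_step (word_power u m) (q i)) \<in> R k i" for k m
    proof (induction m)
      case (Suc m)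
      have "fold lattice_step u ` R k i = R k i" using R_fold[OF that(1)] same by (simp add: u_def)
      moreover have "padic_lattice k (fold cf_step (word_power u (Suc m)) (q i)) =
          fold lattice_step u (padic_lattice k (fold cf_step (word_power u m) (q i)))"
        by (simp only: fold_word_power funpow.simps o_apply padic_lattice_fold)
      ultimately show ?case using Suc by blast
    qed (simp add: q_in_R)
    show ?thesis
    proof (rule padic_word_fixes_or_near_rational[OF q_max, of i u])
      fix M assume "M \<ge> 1" "fst (q i) * snd (fold cf_step (word_power u M) (q i)) =
        fst (fold cf_step (word_power u M) (q i)) * snd (q i)"
      thus ?thesis unfolding u_def by blast
    next
      fix a b :: int
      assume ab: "(a, b) \<noteq> (0, 0)"
        and near: "\<And>k. \<exists>m. padic_abs (of_int a * fst (fold cf_step (word_power u m) (q i)) +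
        of_int b * snd (fold cf_step (word_power u m) (q i))) \<le> 1 / real CARD('p) ^ k"
      \<comment> \<open>At this level the lattice of an orbit point can no longer contain
        \<open>(a, b)\<close>.\<close>
      obtain k where "(1 / real CARD('p)) ^ k < \<epsilon> / real_of_int (max (a\<^sup>2) (b\<^sup>2))"
        using real_arch_pow_inv[OF bad_pos[OF ab], of "1 / real CARD('p)"] real_card_gt_1[where 'p='p] by auto
      hence k: "1 / real CARD('p) ^ k < \<epsilon> / real_of_int (max (a\<^sup>2) (b\<^sup>2))"
        by (simp add: power_divide)
      obtain m where "(a, b) \<in> padic_lattice k (fold cf_step (word_power u m) (q i))"
        using near[of k] by (auto simp: padic_lattice_def)
      then obtain n where "(a, b) \<in> padic_lattice k (q n)"
        using in_R[of k m] R_range[of k i] by auto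
      thus ?thesis using bad[OF ab, of n] k by (simp add: padic_lattice_def)
    qed
  qed

  have irrational: "a = 0 \<and> b = 0"
    if "of_int a * fst (q i) + of_int b * snd (q i) = 0" for a b :: int
    using bad[of a b i] bad_pos[of a b] that by fastforce
  \<comment> \<open>Taking \<open>j > i\<close> makes \<open>v\<close> nonempty, so that its length
    is a genuine period.\<close>
  obtain j where j: "j \<ge> Suc i" "\<And>k. R k j = R k i" using unbounded by blast
  then obtain M where M: "M \<ge> 1"
    "fst (q i) * snd (fold cf_step (word_power (subsequence w i j) M) (q i)) =
      fst (fold cf_step (word_power (subsequence w i j) M) (q i)) * snd (q i)"
    using power_fixes[of j] by auto
  define v where "v = word_power (subsequence w i j) M"
  have "w (n + length v) = w n" if "n \<ge> i" for n
  proof (rule periodic_if_prefix_powers_commute[OF _ that])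
    fix l
    obtain j' where j': "j' \<ge> i + l" "\<And>k. R k j' = R k i" using unbounded by blast
    then obtain M' where M': "M' \<ge> 1"
      "fst (q i) * snd (fold cf_step (word_power (subsequence w i j') M') (q i)) =
        fst (fold cf_step (word_power (subsequence w i j') M') (q i)) * snd (q i)"
      using power_fixes[of j'] by auto
    let ?u = "word_power (subsequence w i j') M'"
    \<comment> \<open>The vector \<open>(1, 2)\<close> lies in the cone required for recovering a
      word from its action.\<close>
    have "fold cf_step (v @ ?u) (1, 2 :: int) = fold cf_step (?u @ v) (1, 2)"
      using M(2) M'(2) irrational
      by (intro fold_cf_step_commute[of "fst (q i)" "snd (q i)"]) (auto simp: v_def)
    hence "v @ ?u = ?u @ v"
      by (rule fold_cf_step_inj) (use pos_w in \<open>auto simp: v_def split: if_splits\<close>)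
    thus "\<exists>j M. j \<ge> i + l \<and> M \<ge> 1 \<and> v @ word_power (subsequence w i j) M = word_power (subsequence w i j) M @ v"
      using j' M'(1) by blast
  qed
  moreover have "length v > 0" using j M by (simp add: v_def length_word_power)
  ultimately have "periodic_word w" using periodic_if_suffix_periodic[OF assms(3)] by blast
  thus False using assms(2) by contradiction
qed

end
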